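(* Let $n\ge 2$, let $Y$ be a $d$-dimensional connected real analytic submanifold of $\mathbb R^n$ with $d\ge 2$, and let $1\le g\le d-1$. Let $f:\mathbb R_{>0}\to\mathbb R_{>0}$ be non-increasing and let $\{R_\ell\}$ be a countable collection of proper closed analytic submanifolds of $Y$. Then $Y\cap\operatorname{UA}_{1,n}(f;g)\smallsetminus\bigcup_{\ell\in\mathbb N}R_\ell$ is uncountable and dense in $Y$. In particular, if in addition $Y$ is not contained in any proper rational affine subspace of $\mathbb R^n$, then $Y\cap\operatorname{UA}^*_{1,n}(f;g)$ is uncountable and dense in $Y$.
   Context: For $f:\mathbb R_{>0}\to\mathbb R_{>0}$ and $1\le g\le n$, $\mathbf{x}\in\mathbb R^n$ belongs to $\operatorname{UA}_{1,n}(f;g)$ ($f$-uniform of order $g$) if for every sufficiently large $t>0$ there exist linearly independent $\mathbf{q}_1,\dots,\mathbf{q}_g\in\mathbb Z^n$ and $p_1,\dots,p_g\in\mathbb Z$ with $\|\mathbf{q}_i\|\le t$ and $|\mathbf{q}_i\cdot\mathbf{x}-p_i|\le f(t)$ for all $i$ (sup norm). $\operatorname{UA}^*_{1,n}(f;g)$ consists of those elements not contained in any proper rational affine subspace of $\mathbb R^n$. *)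

theory Defs
  imports "HOL-Analysis.Analysis"
begin

text \<open>
  Real analytic maps of several variables: near each point the map is the sum of a power series
  in the coordinates. The coefficients are indexed by multi-indices, and \<^const>\<open>has_sum\<close> is
  unconditional (hence, in finite dimension, absolute) convergence.
\<close>

definition real_analytic_at :: "(real^'n \<Rightarrow> real^'m) \<Rightarrow> real^'n \<Rightarrow> bool" where
  "real_analytic_at h x \<longleftrightarrow>
     (\<exists>r>0. \<exists>c :: ('n \<Rightarrow> nat) \<Rightarrow> real^'m. \<forall>y\<in>ball x r.
        ((\<lambda>\<alpha>. (\<Prod>i\<in>UNIV. (y $ i - x $ i) ^ \<alpha> i) *\<^sub>R c \<alpha>) has_sum h y) UNIV)"

definition real_analytic_on :: "(real^'n \<Rightarrow> real^'m) \<Rightarrow> (real^'n) set \<Rightarrow> bool" where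
  "real_analytic_on h U \<longleftrightarrow> (\<forall>x\<in>U. real_analytic_at h x)"

definition analytic_diffeo ::
    "(real^'n) set \<Rightarrow> (real^'n) set \<Rightarrow> (real^'n \<Rightarrow> real^'n) \<Rightarrow> (real^'n \<Rightarrow> real^'n) \<Rightarrow> bool" where
  "analytic_diffeo U V \<phi> \<psi> \<longleftrightarrow>
     open U \<and> open V \<and> homeomorphism U V \<phi> \<psi> \<and> real_analytic_on \<phi> U \<and> real_analytic_on \<psi> V"

text \<open>
  Embedded (not merely immersed) submanifolds, of constant dimension, described by slice charts:
  an analytic change of coordinates of the ambient space turns the set into a linear subspace.
  The empty set is a submanifold of every dimension.
\<close>

definition analytic_submanifold :: "nat \<Rightarrow> (real^'n) set \<Rightarrow> bool" where
  "analytic_submanifold d Y \<longleftrightarrow>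
     (\<forall>x\<in>Y. \<exists>U V \<phi> \<psi> S. x \<in> U \<and> analytic_diffeo U V \<phi> \<psi> \<and>
        subspace S \<and> dim S = d \<and> \<phi> ` (U \<inter> Y) = V \<inter> S)"

text \<open>
  An \<open>e\<close>-dimensional submanifold \<open>R\<close> of the manifold \<open>Y\<close>: here \<open>\<phi>\<close> restricted to \<open>U \<inter> Y\<close> is a
  chart of \<open>Y\<close> with values in \<open>S\<close>, in which \<open>R\<close> is the linear slice \<open>T\<close>.
\<close>

definition analytic_submanifold_of :: "nat \<Rightarrow> (real^'n) set \<Rightarrow> (real^'n) set \<Rightarrow> bool" where
  "analytic_submanifold_of e R Y \<longleftrightarrow> R \<subseteq> Y \<and>
     (\<forall>x\<in>R. \<exists>U V \<phi> \<psi> S T. x \<in> U \<and> analytic_diffeo U V \<phi> \<psi> \<and>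
        subspace S \<and> \<phi> ` (U \<inter> Y) = V \<inter> S \<and>
        subspace T \<and> T \<subseteq> S \<and> dim T = e \<and> \<phi> ` (U \<inter> R) = V \<inter> T)"

definition proper_closed_analytic_submanifold_of :: "(real^'n) set \<Rightarrow> (real^'n) set \<Rightarrow> bool" where
  "proper_closed_analytic_submanifold_of R Y \<longleftrightarrow>
     (\<exists>e. analytic_submanifold_of e R Y) \<and> closedin (top_of_set Y) R \<and> R \<noteq> Y"

text \<open>
  The set \<open>UA f g\<close> is $\mathrm{UA}_{1,n}(f;g)$. Integer vectors are real vectors with integer
  entries; \<^const>\<open>infnorm\<close> is the sup norm. Linear independence of the family \<open>q 1, \<dots>, q g\<close> is
  injectivity together with \<^const>\<open>independent\<close>ce of its range.
\<close>

definition UA :: "(real \<Rightarrow> real) \<Rightarrow> nat \<Rightarrow> (real^'n) set" where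
  "UA f g = {x. \<forall>\<^sub>F t in at_top. \<exists>(q :: nat \<Rightarrow> real^'n) (p :: nat \<Rightarrow> int).
     inj_on q {1..g} \<and> independent (q ` {1..g}) \<and>
     (\<forall>i\<in>{1..g}. (\<forall>j. q i $ j \<in> \<int>) \<and> infnorm (q i) \<le> t \<and> \<bar>q i \<bullet> x - of_int (p i)\<bar> \<le> f t)}"

text \<open>A rational affine subspace is one spanned by points with rational coordinates.\<close>

definition rational_affine_subspace :: "(real^'n) set \<Rightarrow> bool" where
  "rational_affine_subspace A \<longleftrightarrow> (\<exists>P. (\<forall>a\<in>P. \<forall>j. a $ j \<in> \<rat>) \<and> A = affine hull P)"

definition UA_star :: "(real \<Rightarrow> real) \<Rightarrow> nat \<Rightarrow> (real^'n) set" where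
  "UA_star f g = {x \<in> UA f g. \<forall>A. rational_affine_subspace A \<and> A \<noteq> UNIV \<longrightarrow> x \<notin> A}"

end

theory Submission
  imports Defs "HOL-Complex_Analysis.Cauchy_Integral_Formula"
begin

text \<open>
  Near a point, \<open>Y\<close> is a graph over some set \<open>I\<close> of \<open>d\<close> coordinates of \<open>\<real>\<^sup>n\<close>. Starting at a point
  whose coordinates in \<open>I\<close> are rational, one repeatedly moves inside \<open>Y\<close> by a tiny amount in a
  single coordinate \<open>i \<in> I\<close>, running cyclically through \<open>I\<close>, to a new point of the same kind. If \<open>D\<close>
  is a common denominator before the move, then \<open>D e\<^sub>j\<close> for \<open>j \<in> I - {i}\<close> are \<open>d - 1 \<ge> g\<close> integer vectors
  for which the move costs nothing, and the later moves are taken small compared with the value of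
  \<open>f\<close> at the next denominator; so the limit lies in \<open>UA f g\<close>.

  To keep the limit \<open>z\<close> out of a closed set \<open>K\<close>, shrink the neighbourhood in which all later points
  live as soon as the current point is outside \<open>K\<close>. Hence \<open>z \<in> K\<close> forces almost all points of the
  sequence to be in \<open>K\<close>, which is impossible if, near \<open>z\<close>, some coordinate move always leaves
  \<open>K\<close> (\<open>K\<close> is thin at \<open>z\<close>). Singletons and submanifolds of dimension less than \<open>d\<close> are thin at each
  of their points. A hyperplane section \<open>{a \<bullet> y = b}\<close> may be singular, but by analyticity and
  connectedness some iterated derivative of \<open>a \<bullet> y - b\<close> in a chart is nonzero at any of its points
  \<open>z\<close>; just before the first such derivative there is one that vanishes at \<open>z\<close> with nonzero
  differential, and its zero set is thin at \<open>z\<close>.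
\<close>

section \<open>Power series in several variables\<close>

definition monom_at :: "('n::finite \<Rightarrow> nat) \<Rightarrow> real^'n \<Rightarrow> real" where
  "monom_at \<alpha> x = (\<Prod>i\<in>UNIV. x $ i ^ \<alpha> i)"

abbreviation mdeg :: "('n::finite \<Rightarrow> nat) \<Rightarrow> nat" where
  "mdeg \<alpha> \<equiv> sum \<alpha> UNIV"

text \<open>Absolute summability is demanded at the corner (s, ..., s) of a cube that contains the
  ball of radius s. It is the majorant behind all termwise estimates.\<close>

definition has_power_series ::
    "(real^'n \<Rightarrow> real) \<Rightarrow> (('n \<Rightarrow> nat) \<Rightarrow> real) \<Rightarrow> real \<Rightarrow> real^'n \<Rightarrow> bool" where
  "has_power_series w c s a \<longleftrightarrow> s > 0 \<and> (\<lambda>\<alpha>. \<bar>c \<alpha>\<bar> * s ^ mdeg \<alpha>) summable_on UNIV \<and>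
     (\<forall>y\<in>ball a s. ((\<lambda>\<alpha>. c \<alpha> * monom_at \<alpha> (y - a)) has_sum w y) UNIV)"

definition scalar_analytic_at :: "(real^'n \<Rightarrow> real) \<Rightarrow> real^'n \<Rightarrow> bool" where
  "scalar_analytic_at w a \<longleftrightarrow> (\<exists>c s. has_power_series w c s a)"

text \<open>
  Strict differentiability at the centre of a power series needs no expansion at other points, and
  it is enough for local injectivity.
\<close>

definition strict_deriv ::
    "('a::real_normed_vector \<Rightarrow> 'b::real_normed_vector) \<Rightarrow> ('a \<Rightarrow> 'b) \<Rightarrow> 'a \<Rightarrow> bool" where
  "strict_deriv f f' a \<longleftrightarrow> bounded_linear f' \<and> (\<forall>e>0. \<exists>r>0. \<forall>x\<in>ball a r. \<forall>y\<in>ball a r.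
     norm (f x - f y - f' (x - y)) \<le> e * norm (x - y))"

section \<open>Bounds for monomials\<close>

lemma monom_at_scaleR: "monom_at \<alpha> (t *\<^sub>R x) = t ^ mdeg \<alpha> * monom_at \<alpha> x"
  unfolding monom_at_def by (simp add: power_mult_distrib prod.distrib power_sum)

lemma abs_monom_at_le:
  assumes "\<And>i. \<bar>x $ i\<bar> \<le> \<rho>"
  shows "\<bar>monom_at \<alpha> x\<bar> \<le> \<rho> ^ mdeg \<alpha>"
  unfolding monom_at_def abs_prod power_sum
  by (intro prod_mono) (auto simp: power_abs intro!: power_mono assms)

text \<open>After rescaling to the cube [-1, 1]^n, a difference of products is at most the sum of
  the differences of the factors, and the k-th power is k-Lipschitz there.\<close>

lemma monom_at_diff_le:
  assumes x: "\<And>i. \<bar>x $ i\<bar> \<le> \<rho>" and y: "\<And>i. \<bar>y $ i\<bar> \<le> \<rho>" and "\<rho> > 0"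
  shows "\<bar>monom_at \<alpha> x - monom_at \<alpha> y\<bar> \<le> real (mdeg \<alpha>) * \<rho> ^ (mdeg \<alpha> - 1) * norm (x - y)"
proof -
  define u v where "u = inverse \<rho> *\<^sub>R x" and "v = inverse \<rho> *\<^sub>R y"
  have u: "\<bar>u $ i\<bar> \<le> 1" and v: "\<bar>v $ i\<bar> \<le> 1" for i
    using x[of i] y[of i] \<open>\<rho> > 0\<close> by (simp_all add: u_def v_def abs_mult field_simps)
  have xu: "x = \<rho> *\<^sub>R u" "y = \<rho> *\<^sub>R v"
    using \<open>\<rho> > 0\<close> by (simp_all add: u_def v_def)
  have "\<bar>monom_at \<alpha> u - monom_at \<alpha> v\<bar> \<le> (\<Sum>i\<in>UNIV. norm (u $ i ^ \<alpha> i - v $ i ^ \<alpha> i))"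
    unfolding monom_at_def real_norm_def[symmetric]
    by (rule norm_prod_diff) (use u v in \<open>auto simp: power_abs intro!: power_le_one\<close>)
  also have "\<dots> \<le> (\<Sum>i\<in>UNIV. real (\<alpha> i) * norm (u - v))"
  proof (intro sum_mono)
    fix i
    have "norm (u $ i ^ \<alpha> i - v $ i ^ \<alpha> i) \<le> real (\<alpha> i) * norm (u $ i - v $ i)"
      by (rule norm_power_diff) (use u v in auto)
    also have "\<dots> \<le> real (\<alpha> i) * norm (u - v)"
      using component_le_norm_cart[of "u - v" i] by (intro mult_left_mono) auto
    finally show "norm (u $ i ^ \<alpha> i - v $ i ^ \<alpha> i) \<le> real (\<alpha> i) * norm (u - v)" .
  qed
  also have "\<dots> = real (mdeg \<alpha>) * norm (u - v)"
    by (simp add: sum_distrib_right)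
  finally have *: "\<bar>monom_at \<alpha> u - monom_at \<alpha> v\<bar> \<le> real (mdeg \<alpha>) * norm (u - v)" .
  have "\<bar>monom_at \<alpha> x - monom_at \<alpha> y\<bar> = \<rho> ^ mdeg \<alpha> * \<bar>monom_at \<alpha> u - monom_at \<alpha> v\<bar>"
    using \<open>\<rho> > 0\<close> by (simp add: xu monom_at_scaleR abs_mult flip: right_diff_distrib)
  also have "\<dots> \<le> \<rho> ^ mdeg \<alpha> * (real (mdeg \<alpha>) * norm (u - v))"
    using * \<open>\<rho> > 0\<close> by (intro mult_left_mono) auto
  \<comment> \<open>Undoing the rescaling costs one power of \<rho>. In degree 0 the truncated
    exponent is harmless because the factor \<open>mdeg \<alpha>\<close> vanishes.\<close>
  also have "\<dots> = real (mdeg \<alpha>) * \<rho> ^ (mdeg \<alpha> - 1) * norm (x - y)"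
    using \<open>\<rho> > 0\<close> by (cases "mdeg \<alpha>") (simp_all add: xu flip: scaleR_diff_right)
  finally show ?thesis .
qed

section \<open>Change of radius and linear operations on power series\<close>

lemma has_power_series_subset:
  assumes "has_power_series w c s a" "0 < s'" "s' \<le> s"
  shows "has_power_series w c s' a"
proof -
  have "(\<lambda>\<alpha>. \<bar>c \<alpha>\<bar> * s' ^ mdeg \<alpha>) summable_on UNIV"
    by (rule summable_on_comparison_test[of "\<lambda>\<alpha>. \<bar>c \<alpha>\<bar> * s ^ mdeg \<alpha>"])
       (use assms in \<open>auto simp: has_power_series_def intro!: mult_left_mono power_mono\<close>)
  then show ?thesis
    using assms by (auto simp: has_power_series_def)
qed

lemma mdeg_eq_0_iff: "mdeg \<alpha> = 0 \<longleftrightarrow> \<alpha> = (\<lambda>_. 0)"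
  by (auto simp: fun_eq_iff)

lemma monom_at_zero [simp]: "monom_at (\<lambda>_. 0) x = 1"
  by (simp add: monom_at_def)

lemma scalar_analytic_at_const [simp]: "scalar_analytic_at (\<lambda>_. b) (a::real^'n)"
proof -
  have "has_power_series (\<lambda>_. b) (\<lambda>\<alpha>. if \<alpha> = (\<lambda>_. 0) then b else 0) 1 a"
    unfolding has_power_series_def
  proof (intro conjI ballI)
    show "(\<lambda>\<alpha>::'n \<Rightarrow> nat. \<bar>if \<alpha> = (\<lambda>_. 0) then b else 0\<bar> * 1 ^ mdeg \<alpha>) summable_on UNIV"
      by (rule finite_nonzero_values_imp_summable_on) (rule finite_subset[of _ "{\<lambda>_. 0}"], auto)
    show "((\<lambda>\<alpha>. (if \<alpha> = (\<lambda>_. 0) then b else 0) * monom_at \<alpha> (y - a)) has_sum b) UNIV" for y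
      by (rule has_sum_finite_neutralI[of "{\<lambda>_. 0}"]) auto
  qed simp
  then show ?thesis by (auto simp: scalar_analytic_at_def)
qed

lemma scalar_analytic_at_add:
  assumes "scalar_analytic_at v a" "scalar_analytic_at w a"
  shows "scalar_analytic_at (\<lambda>x. v x + w x) a"
proof -
  obtain c s c' s' where "has_power_series v c s a" "has_power_series w c' s' a"
    using assms unfolding scalar_analytic_at_def by blast
  moreover from this have "0 < min s s'"
    by (auto simp: has_power_series_def)
  ultimately have v: "has_power_series v c (min s s') a" and w: "has_power_series w c' (min s s') a"
    by (meson has_power_series_subset min.cobounded1 min.cobounded2)+
  have "(\<lambda>\<alpha>. \<bar>c \<alpha> + c' \<alpha>\<bar> * min s s' ^ mdeg \<alpha>) summable_on UNIV"
    by (rule summable_on_comparison_test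
          [OF summable_on_add[of "\<lambda>\<alpha>. \<bar>c \<alpha>\<bar> * min s s' ^ mdeg \<alpha>" UNIV
              "\<lambda>\<alpha>. \<bar>c' \<alpha>\<bar> * min s s' ^ mdeg \<alpha>"]])
       (use v w in \<open>auto simp: has_power_series_def simp flip: distrib_right
          intro!: mult_right_mono\<close>)
  then have "has_power_series (\<lambda>x. v x + w x) (\<lambda>\<alpha>. c \<alpha> + c' \<alpha>) (min s s') a"
    using v w by (auto simp: has_power_series_def distrib_right intro!: has_sum_add)
  then show ?thesis by (auto simp: scalar_analytic_at_def)
qed

lemma scalar_analytic_at_cmult:
  assumes "scalar_analytic_at w a"
  shows "scalar_analytic_at (\<lambda>x. k * w x) a"
proof -
  obtain c s where w: "has_power_series w c s a"
    using assms unfolding scalar_analytic_at_def by blast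
  then have "has_power_series (\<lambda>x. k * w x) (\<lambda>\<alpha>. k * c \<alpha>) s a"
    by (auto simp: has_power_series_def abs_mult mult.assoc
        intro!: summable_on_cmult_right has_sum_cmult_right)
  then show ?thesis by (auto simp: scalar_analytic_at_def)
qed

lemma scalar_analytic_at_sum:
  assumes "\<And>j. j \<in> J \<Longrightarrow> scalar_analytic_at (w j) a"
  shows "scalar_analytic_at (\<lambda>x. \<Sum>j\<in>J. w j x) a"
  using assms by (induction J rule: infinite_finite_induct) (auto intro: scalar_analytic_at_add)

text \<open>Unconditional convergence at the single point a + (s, ..., s) already means absolute
  summability of the coefficients against s ^ mdeg, the extra clause of
  \<open>has_power_series\<close>.\<close>

lemma real_analytic_at_imp_scalar:
  fixes h :: "real^'n \<Rightarrow> real^'m"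
  assumes "real_analytic_at h a"
  shows "scalar_analytic_at (\<lambda>x. v \<bullet> h x) a"
proof -
  obtain r and c :: "('n \<Rightarrow> nat) \<Rightarrow> real^'m" where r: "r > 0" and
    c: "\<And>y. y \<in> ball a r \<Longrightarrow> ((\<lambda>\<alpha>. monom_at \<alpha> (y - a) *\<^sub>R c \<alpha>) has_sum h y) UNIV"
    using assms unfolding real_analytic_at_def monom_at_def vector_minus_component by blast
  have c': "((\<lambda>\<alpha>. (v \<bullet> c \<alpha>) * monom_at \<alpha> (y - a)) has_sum v \<bullet> h y) UNIV" if "y \<in> ball a r" for y
    using has_sum_bounded_linear[OF bounded_linear_inner_right c[OF that], of v]
    by (simp add: mult.commute)
  \<comment> \<open>The corner has norm at most \<open>CARD('n)\<close> times s, which is r / 2, so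
    it lies in the ball of convergence.\<close>
  define s where "s = r / (2 * CARD('n))"
  have s: "s > 0" "s \<le> r" using r
    by (auto simp: s_def divide_le_eq mult_le_cancel_left1 Suc_le_eq
        intro: order_trans[of _ "real CARD('n)"])
  define b :: "real^'n" where "b = (\<chi> i. s)"
  have "norm b \<le> (\<Sum>i\<in>UNIV. \<bar>b $ i\<bar>)"
    by (rule norm_le_l1_cart)
  also have "\<dots> < r"
    using r s by (simp add: b_def s_def)
  finally have "a + b \<in> ball a r"
    by (simp add: dist_norm)
  from c'[OF this] have "(\<lambda>\<alpha>. \<bar>(v \<bullet> c \<alpha>) * monom_at \<alpha> b\<bar>) summable_on UNIV"
    unfolding real_norm_def[symmetric] summable_on_iff_abs_summable_on_real[symmetric] by (auto simp: summable_on_def)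
  moreover have "monom_at \<alpha> b = s ^ mdeg \<alpha>" for \<alpha>
    by (simp add: monom_at_def b_def power_sum)
  ultimately have "has_power_series (\<lambda>x. v \<bullet> h x) (\<lambda>\<alpha>. v \<bullet> c \<alpha>) s a"
    using s c' by (auto simp: has_power_series_def abs_mult)
  then show ?thesis by (auto simp: scalar_analytic_at_def)
qed

section \<open>Strict differentiability at the centre of a power series\<close>

lemma has_sum_diff:
  fixes f g :: "'a \<Rightarrow> 'b::real_normed_vector"
  assumes "(f has_sum x) A" "(g has_sum y) A"
  shows "((\<lambda>i. f i - g i) has_sum (x - y)) A"
  using has_sum_add[OF assms(1), of "\<lambda>i. - g i" "- y"] assms(2) by (simp add: has_sum_uminus)

lemma of_nat_le_two_pow: "real k \<le> 2 ^ (k - 1)"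
proof (cases k)
  case (Suc n)
  have "Suc n \<le> 2 ^ n" by (simp add: Suc_leI)
  then have "real (Suc n) \<le> real (2 ^ n)" by (rule of_nat_mono)
  then show ?thesis by (simp add: Suc)
qed simp

text \<open>The constant term cancels in w x - w y and the terms of degree one form the linear map,
  so only degrees k >= 2 remain. On a ball of radius d their Lipschitz constants carry a factor k *
  d ^ (k - 1), small against s ^ k for small d.\<close>

lemma has_power_series_strict_deriv:
  assumes w: "has_power_series w c s a"
  shows "strict_deriv w (\<lambda>h. \<Sum>i\<in>UNIV. c (\<lambda>j. if j = i then 1 else 0) * h $ i) a"
    (is "strict_deriv w ?L a")
  unfolding strict_deriv_def
proof (intro conjI allI impI)
  show "bounded_linear ?L"
    by (intro bounded_linear_sum bounded_linear_const_mult bounded_linear_vec_nth)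
  fix e :: real assume "e > 0"
  have s: "s > 0" and sm: "(\<lambda>\<alpha>. \<bar>c \<alpha>\<bar> * s ^ mdeg \<alpha>) summable_on UNIV"
    using w by (auto simp: has_power_series_def)
  define M where "M = (\<Sum>\<^sub>\<infinity>\<alpha>. \<bar>c \<alpha>\<bar> * s ^ mdeg \<alpha>)"
  have M0: "M \<ge> 0"
    unfolding M_def using s by (intro infsum_nonneg) auto
  \<comment> \<open>The bound s / 2 absorbs k <= 2 ^ (k - 1) and gives k * d ^ (k - 1) <= (2 * d /
    s^2) * s ^ k for k >= 2; the second bound makes the total at most e. Using M + 1 avoids a
    division by zero.\<close>
  define d where "d = min (s/2) (e * s\<^sup>2 / (2 * (M + 1)))"
  have d: "d > 0" "d \<le> s/2" and de: "2 * d * M / s\<^sup>2 \<le> e"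
  proof -
    show "d > 0" using s \<open>e > 0\<close> M0 by (auto simp: d_def)
    show "d \<le> s/2" unfolding d_def by (rule min.cobounded1)
    have "d \<le> e * s\<^sup>2 / (2 * (M + 1))" by (simp add: d_def)
    then have "2 * d * (M + 1) \<le> e * s\<^sup>2" using M0 by (simp add: field_simps)
    then have "2 * d * M \<le> e * s\<^sup>2" using \<open>d > 0\<close> by (simp add: field_simps)
    then show "2 * d * M / s\<^sup>2 \<le> e" using s by (simp add: field_simps)
  qed
  \<comment> \<open>These are the multi-indices of degree one; their monomials are the coordinate
    functions.\<close>
  define u :: "'a \<Rightarrow> 'a \<Rightarrow> nat" where "u i = (\<lambda>j. if j = i then 1 else 0)" for i
  have inju: "inj u" by (auto simp: inj_def u_def fun_eq_iff split: if_splits)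
  have degu: "mdeg (u i) = 1" for i by (simp add: u_def)
  have monu: "monom_at (u i) x = x $ i" for i x
    unfolding monom_at_def u_def by (subst prod.remove[of _ i]) (auto intro!: prod.neutral)
  have deg2: "mdeg \<alpha> \<ge> 2" if "\<alpha> \<notin> range u" "\<alpha> \<noteq> (\<lambda>_. 0)" for \<alpha>
  proof (rule ccontr)
    assume "\<not> mdeg \<alpha> \<ge> 2"
    with that(2) have "mdeg \<alpha> = Suc 0"
      using mdeg_eq_0_iff[of \<alpha>] by linarith
    then obtain i where "\<alpha> i = Suc 0" "\<And>j. j \<noteq> i \<Longrightarrow> \<alpha> j = 0"
      by (auto simp: sum_eq_Suc0_iff)
    then have "\<alpha> = u i" by (auto simp: u_def fun_eq_iff)
    with that show False by auto
  qed
  show "\<exists>r>0. \<forall>x\<in>ball a r. \<forall>y\<in>ball a r. norm (w x - w y - ?L (x - y)) \<le> e * norm (x - y)"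
  proof (intro exI[of _ d] conjI ballI)
    fix x y assume x: "x \<in> ball a d" and y: "y \<in> ball a d"
    have xi: "\<bar>(x - a) $ i\<bar> \<le> d" and yi: "\<bar>(y - a) $ i\<bar> \<le> d" for i
      using x y component_le_norm_cart[of "x - a" i] component_le_norm_cart[of "y - a" i]
      by (auto simp: dist_norm norm_minus_commute)
    let ?t = "\<lambda>\<alpha>. c \<alpha> * (monom_at \<alpha> (x - a) - monom_at \<alpha> (y - a))"
    have "x \<in> ball a s" "y \<in> ball a s" using x y d s by auto
    then have 1: "(?t has_sum w x - w y) UNIV"
      using w unfolding has_power_series_def right_diff_distrib
      by (intro has_sum_diff) blast+
    have 2: "(?t has_sum ?L (x - y)) (range u)"
      by (rule has_sum_finiteI)
         (auto simp: sum.reindex[OF inju] monu u_def[symmetric])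
    have 3: "(?t has_sum (w x - w y - ?L (x - y))) (UNIV - range u)"
      by (rule has_sum_Diff[OF 1 2]) auto
    have 4: "((\<lambda>\<alpha>. (2 * d / s\<^sup>2 * norm (x - y)) * (\<bar>c \<alpha>\<bar> * s ^ mdeg \<alpha>)) has_sum
       (2 * d / s\<^sup>2 * norm (x - y)) * infsum (\<lambda>\<alpha>. \<bar>c \<alpha>\<bar> * s ^ mdeg \<alpha>) (UNIV - range u)) (UNIV - range u)"
      by (intro has_sum_cmult_right has_sum_infsum summable_on_subset[OF sm]) auto
    have "norm (w x - w y - ?L (x - y)) \<le>
        (2 * d / s\<^sup>2 * norm (x - y)) * infsum (\<lambda>\<alpha>. \<bar>c \<alpha>\<bar> * s ^ mdeg \<alpha>) (UNIV - range u)"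
    proof (rule norm_infsum_le[OF 3 4])
      fix \<alpha> assume \<alpha>: "\<alpha> \<in> UNIV - range u"
      show "norm (?t \<alpha>) \<le> (2 * d / s\<^sup>2 * norm (x - y)) * (\<bar>c \<alpha>\<bar> * s ^ mdeg \<alpha>)"
      proof (cases "\<alpha> = (\<lambda>_. 0)")
        case True then show ?thesis using d s by simp
      next
        case False
        obtain k where k: "mdeg \<alpha> = Suc (Suc k)"
          using le_Suc_ex[OF deg2[of \<alpha>]] \<alpha> False by (auto simp: numeral_2_eq_2)
        have "real (mdeg \<alpha>) * d ^ (mdeg \<alpha> - 1) \<le> 2 ^ Suc k * (d * (s/2) ^ k)"
          using d s of_nat_le_two_pow[of "mdeg \<alpha>"] unfolding k
          by (intro mult_mono) (auto intro!: mult_left_mono power_mono)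
        also have "\<dots> = 2 * d / s\<^sup>2 * s ^ mdeg \<alpha>"
        proof -
          have "2 ^ k * (s / 2) ^ k = s ^ k" by (simp flip: power_mult_distrib)
          moreover have "s ^ mdeg \<alpha> = s\<^sup>2 * s ^ k" unfolding k by (simp add: power2_eq_square)
          ultimately show ?thesis using s by simp
        qed
        finally have *: "real (mdeg \<alpha>) * d ^ (mdeg \<alpha> - 1) \<le> 2 * d / s\<^sup>2 * s ^ mdeg \<alpha>" .
        have "\<bar>monom_at \<alpha> (x - a) - monom_at \<alpha> (y - a)\<bar> \<le>
            real (mdeg \<alpha>) * d ^ (mdeg \<alpha> - 1) * norm ((x - a) - (y - a))"
          by (rule monom_at_diff_le[OF xi yi d(1)])
        also have "\<dots> \<le> 2 * d / s\<^sup>2 * s ^ mdeg \<alpha> * norm (x - y)"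
          unfolding diff_diff_eq2 diff_add_cancel by (intro mult_right_mono * norm_ge_zero)
        finally have "\<bar>c \<alpha>\<bar> * \<bar>monom_at \<alpha> (x - a) - monom_at \<alpha> (y - a)\<bar> \<le>
            \<bar>c \<alpha>\<bar> * (2 * d / s\<^sup>2 * s ^ mdeg \<alpha> * norm (x - y))"
          by (intro mult_left_mono) auto
        then show ?thesis by (simp add: abs_mult mult_ac)
      qed
    qed
    also have "\<dots> \<le> (2 * d / s\<^sup>2 * norm (x - y)) * M"
      unfolding M_def using d s
      by (intro mult_left_mono infsum_mono_neutral summable_on_subset[OF sm] sm) auto
    also have "\<dots> = 2 * d * M / s\<^sup>2 * norm (x - y)" by simp
    also have "\<dots> \<le> e * norm (x - y)" using de by (intro mult_right_mono) auto
    finally show "norm (w x - w y - ?L (x - y)) \<le> e * norm (x - y)" .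
  qed (use d in auto)
qed

section \<open>Directional derivatives of analytic functions\<close>

definition partial_at :: "'n \<Rightarrow> (real^'n \<Rightarrow> real) \<Rightarrow> real^'n \<Rightarrow> real" where
  "partial_at i w p = deriv (\<lambda>t. w (p + t *\<^sub>R axis i 1)) 0"

text \<open>Pairing v with the vector of partial derivatives makes linearity in v immediate and
  reduces analyticity to the partial derivatives. At analytic points it is the true directional
  derivative by \<open>scalar_analytic_at_strict_deriv\<close>.\<close>

definition dir_deriv :: "real^'n \<Rightarrow> (real^'n \<Rightarrow> real) \<Rightarrow> real^'n \<Rightarrow> real" where
  "dir_deriv v w p = v \<bullet> (\<chi> i. partial_at i w p)"

section \<open>Termwise differentiation\<close>

lemma monom_at_remove:
  "monom_at \<alpha> x = x $ i ^ \<alpha> i * (\<Prod>j\<in>UNIV - {i}. x $ j ^ \<alpha> j)"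
  unfolding monom_at_def by (rule prod.remove) auto

lemma mdeg_remove: "mdeg \<alpha> = \<alpha> i + sum \<alpha> (UNIV - {i})"
  by (rule sum.remove) auto

text \<open>Only the i-th factor varies, so the one-variable second-order error bound for powers is
  multiplied by a bound for the product of the other factors.\<close>

lemma monom_at_quotient_le:
  fixes x :: "real^'n"
  assumes x: "\<And>j. \<bar>x $ j\<bar> \<le> K" and xt: "\<bar>x $ i + t\<bar> \<le> K" and "t \<noteq> 0"
  shows "\<bar>(monom_at \<alpha> (x + t *\<^sub>R axis i 1) - monom_at \<alpha> x) / t
           - real (\<alpha> i) * monom_at (\<alpha>(i := \<alpha> i - 1)) x\<bar>
         \<le> real (\<alpha> i) * real (\<alpha> i - 1) * K ^ (mdeg \<alpha> - 2) * \<bar>t\<bar>"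
proof -
  define P where "P = (\<Prod>j\<in>UNIV - {i}. x $ j ^ \<alpha> j)"
  define m where "m = sum \<alpha> (UNIV - {i})"
  have K: "K \<ge> 0" using xt by linarith
  have P: "\<bar>P\<bar> \<le> K ^ m"
    unfolding P_def m_def abs_prod power_sum
    by (intro prod_mono) (auto simp: power_abs intro!: power_mono x)
  have 1: "monom_at \<alpha> x = x $ i ^ \<alpha> i * P"
    unfolding P_def by (rule monom_at_remove)
  have 2: "monom_at \<alpha> (x + t *\<^sub>R axis i 1) = (x $ i + t) ^ \<alpha> i * P"
    unfolding P_def by (subst monom_at_remove[of _ _ i]) (simp add: axis_def)
  have 3: "monom_at (\<alpha>(i := \<alpha> i - 1)) x = x $ i ^ (\<alpha> i - 1) * P"
    unfolding P_def by (subst monom_at_remove[of _ _ i]) simp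
  have "(monom_at \<alpha> (x + t *\<^sub>R axis i 1) - monom_at \<alpha> x) / t
           - real (\<alpha> i) * monom_at (\<alpha>(i := \<alpha> i - 1)) x
     = (((x $ i + t) ^ \<alpha> i - x $ i ^ \<alpha> i) / t - real (\<alpha> i) * x $ i ^ (\<alpha> i - 1)) * P"
    unfolding 1 2 3 by (simp add: algebra_simps diff_divide_distrib)
  also have "\<bar>\<dots>\<bar> \<le> (real (\<alpha> i) * real (\<alpha> i - 1) * K ^ (\<alpha> i - 2) * \<bar>t\<bar>) * K ^ m"
    unfolding abs_mult[of _ P]
    using lemma_termdiff3[of t "x $ i" K "\<alpha> i"] x[of i] xt \<open>t \<noteq> 0\<close> P K
    by (intro mult_mono) auto
  \<comment> \<open>For \<alpha> i < 2 the truncated exponents need not add up, but then the factor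
    \<alpha> i * (\<alpha> i - 1) is zero.\<close>
  also have "\<dots> = real (\<alpha> i) * real (\<alpha> i - 1) * K ^ (mdeg \<alpha> - 2) * \<bar>t\<bar>"
  proof (cases "\<alpha> i \<ge> 2")
    case True
    then have "mdeg \<alpha> - 2 = (\<alpha> i - 2) + m"
      unfolding m_def by (subst mdeg_remove[of _ i]) simp
    then show ?thesis by (simp only: power_add mult_ac)
  next
    case False
    then have "\<alpha> i = 0 \<or> \<alpha> i - 1 = 0" by linarith
    then show ?thesis by auto
  qed
  finally show ?thesis .
qed

lemma sq_le_two_pow: "real k * real (k - 1) \<le> 2 * 2 ^ k"
proof (induction k)
  case (Suc k)
  have "real k \<le> 2 ^ k" by (metis of_nat_le_two_pow order.trans power_increasing diff_le_self one_le_numeral)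
  then show ?case using Suc by (cases k) (auto simp: algebra_simps)
qed simp

text \<open>The formal derivative series is summed first; the difference quotients of w then differ
  from its sum by O(t), since the second-order errors of the monomials are dominated by the original
  series. The smaller radius absorbs the factors \<beta> i + 1 and \<alpha> i * (\<alpha> i - 1),
  which grow at most like 2 ^ mdeg up to a constant.\<close>

lemma has_power_series_partial:
  fixes w :: "real^'n \<Rightarrow> real"
  assumes w: "has_power_series w c s a"
  shows "has_power_series (partial_at i w) (\<lambda>\<beta>. real (\<beta> i + 1) * c (\<beta>(i := \<beta> i + 1))) (s/4) a"
    (is "has_power_series _ ?d _ _")
proof -
  have s: "s > 0" and sm: "(\<lambda>\<alpha>. \<bar>c \<alpha>\<bar> * s ^ mdeg \<alpha>) summable_on UNIV"
    and ws: "\<And>y. y \<in> ball a s \<Longrightarrow> ((\<lambda>\<alpha>. c \<alpha> * monom_at \<alpha> (y - a)) has_sum w y) UNIV"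
    using w by (auto simp: has_power_series_def)
  define up :: "('n \<Rightarrow> nat) \<Rightarrow> ('n \<Rightarrow> nat)" where "up \<beta> = \<beta>(i := \<beta> i + 1)" for \<beta>
  have inj: "inj up"
  proof (rule injI)
    fix \<beta> \<gamma> assume eq: "up \<beta> = up \<gamma>"
    have "\<beta> j = \<gamma> j" for j using fun_cong[OF eq, of j] by (auto simp: up_def split: if_splits)
    then show "\<beta> = \<gamma>" by auto
  qed
  have ran: "\<alpha> \<in> range up" if "\<alpha> i > 0" for \<alpha>
    using that by (intro image_eqI[of _ _ "\<alpha>(i := \<alpha> i - 1)"]) (auto simp: up_def fun_eq_iff)
  have mdeg_up: "mdeg (up \<beta>) = Suc (mdeg \<beta>)" for \<beta>
    by (subst (1 2) mdeg_remove[of _ i]) (auto simp: up_def intro!: sum.cong)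
  have "(\<lambda>\<alpha>. \<bar>c \<alpha>\<bar> * s ^ mdeg \<alpha>) summable_on range up"
    using sm by (rule summable_on_subset) auto
  then have "(\<lambda>\<beta>. \<bar>c (up \<beta>)\<bar> * s ^ mdeg (up \<beta>)) summable_on UNIV"
    using summable_on_reindex[OF inj, of "\<lambda>\<alpha>. \<bar>c \<alpha>\<bar> * s ^ mdeg \<alpha>"] by (simp add: o_def)
  then have "(\<lambda>\<beta>. 1 / s * (\<bar>c (up \<beta>)\<bar> * s ^ mdeg (up \<beta>))) summable_on UNIV"
    by (rule summable_on_cmult_right)
  then have smd: "(\<lambda>\<beta>. \<bar>?d \<beta>\<bar> * (s/4) ^ mdeg \<beta>) summable_on UNIV"
  proof (rule summable_on_comparison_test)
    fix \<beta> :: "'n \<Rightarrow> nat"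
    show "0 \<le> \<bar>?d \<beta>\<bar> * (s/4) ^ mdeg \<beta>" using s by simp
    have "real (\<beta> i + 1) \<le> 2 ^ \<beta> i"
      using of_nat_le_two_pow[of "\<beta> i + 1"] by simp
    also have "\<dots> \<le> 2 ^ mdeg \<beta>"
      by (intro power_increasing member_le_sum) auto
    also have "\<dots> \<le> 4 ^ mdeg \<beta>"
      by (intro power_mono) auto
    finally have "real (\<beta> i + 1) * (s/4) ^ mdeg \<beta> \<le> 4 ^ mdeg \<beta> * (s/4) ^ mdeg \<beta>"
      using s by (intro mult_right_mono) auto
    also have "\<dots> = s ^ mdeg \<beta>" by (simp flip: power_mult_distrib)
    finally have "\<bar>c (up \<beta>)\<bar> * (real (\<beta> i + 1) * (s/4) ^ mdeg \<beta>) \<le> \<bar>c (up \<beta>)\<bar> * s ^ mdeg \<beta>"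
      by (intro mult_left_mono) auto
    then show "\<bar>?d \<beta>\<bar> * (s/4) ^ mdeg \<beta> \<le> 1 / s * (\<bar>c (up \<beta>)\<bar> * s ^ mdeg (up \<beta>))"
      using s unfolding mdeg_up by (simp add: abs_mult mult_ac up_def)
  qed
  define M where "M = (\<Sum>\<^sub>\<infinity>\<alpha>. \<bar>c \<alpha>\<bar> * s ^ mdeg \<alpha>)"
  have "((\<lambda>\<beta>. ?d \<beta> * monom_at \<beta> (p - a)) has_sum partial_at i w p) UNIV"
    if p: "p \<in> ball a (s/4)" for p
  proof -
    define x where "x = p - a"
    have nx: "norm x < s/4" using p by (simp add: x_def dist_norm norm_minus_commute)
    have xj: "\<bar>x $ j\<bar> \<le> s/4" for j
      using component_le_norm_cart[of x j] nx by linarith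
    define D where "D = (\<Sum>\<^sub>\<infinity>\<beta>. ?d \<beta> * monom_at \<beta> x)"
    have "(\<lambda>\<beta>. norm (?d \<beta> * monom_at \<beta> x)) summable_on UNIV"
      using smd
    proof (rule summable_on_comparison_test)
      fix \<beta> :: "'n \<Rightarrow> nat"
      show "norm (?d \<beta> * monom_at \<beta> x) \<le> \<bar>?d \<beta>\<bar> * (s/4) ^ mdeg \<beta>"
        unfolding real_norm_def abs_mult[of "?d \<beta>"]
        by (intro mult_left_mono abs_monom_at_le xj abs_ge_zero)
    qed (rule norm_ge_zero)
    then have D: "((\<lambda>\<beta>. ?d \<beta> * monom_at \<beta> x) has_sum D) UNIV"
      unfolding D_def by (rule has_sum_infsum[OF abs_summable_summable])
    let ?g = "\<lambda>\<alpha>. c \<alpha> * (real (\<alpha> i) * monom_at (\<alpha>(i := \<alpha> i - 1)) x)"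
    have "?g (up \<beta>) = ?d \<beta> * monom_at \<beta> x" for \<beta>
      by (simp add: up_def)
    with D have "(?g has_sum D) (range up)"
      by (subst has_sum_reindex[OF inj]) (simp add: o_def)
    \<comment> \<open>Multi-indices outside the range of \<open>up\<close> have \<alpha> i = 0, so
      their terms vanish.\<close>
    then have D': "(?g has_sum D) UNIV"
      by (subst has_sum_cong_neutral[where S = UNIV and T = "range up" and g = ?g])
         (use ran in force)+
    \<comment> \<open>The coordinates of x and t are at most s / 4, so the monomial estimate applies
      with K = s / 2. In degree m + 2 the constant comes from 2 * 2 ^ (m + 2) * (s / 2) ^ m = 8 * s
      ^ m.\<close>
    have bound: "\<bar>(w (p + t *\<^sub>R axis i 1) - w p) / t - D\<bar> \<le> 8 * M / s\<^sup>2 * \<bar>t\<bar>"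
      if t: "t \<noteq> 0" "\<bar>t\<bar> < s/4" for t
    proof -
      have "norm (x + t *\<^sub>R axis i 1) < s/4 + s/4"
        using norm_triangle_ineq[of x "t *\<^sub>R axis i 1"] nx t by (simp add: norm_axis_1)
      then have "p + t *\<^sub>R axis i 1 \<in> ball a s"
        using s by (simp add: x_def dist_norm norm_minus_commute algebra_simps)
      from ws[OF this] have w1: "((\<lambda>\<alpha>. c \<alpha> * monom_at \<alpha> (x + t *\<^sub>R axis i 1)) has_sum
          w (p + t *\<^sub>R axis i 1)) UNIV" by (simp add: x_def algebra_simps)
      have w2: "((\<lambda>\<alpha>. c \<alpha> * monom_at \<alpha> x) has_sum w p) UNIV"
        using ws[of p] p s unfolding x_def by auto
      have "((\<lambda>\<alpha>. (1/t) * (c \<alpha> * monom_at \<alpha> (x + t *\<^sub>R axis i 1) - c \<alpha> * monom_at \<alpha> x) - ?g \<alpha>)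
          has_sum (1/t) * (w (p + t *\<^sub>R axis i 1) - w p) - D) UNIV"
        by (intro has_sum_diff has_sum_cmult_right w1 w2 D')
      then have A: "((\<lambda>\<alpha>. c \<alpha> * ((monom_at \<alpha> (x + t *\<^sub>R axis i 1) - monom_at \<alpha> x) / t
            - real (\<alpha> i) * monom_at (\<alpha>(i := \<alpha> i - 1)) x))
          has_sum (w (p + t *\<^sub>R axis i 1) - w p) / t - D) UNIV"
        by (simp add: algebra_simps diff_divide_distrib)
      have B: "((\<lambda>\<alpha>. (8 / s\<^sup>2 * \<bar>t\<bar>) * (\<bar>c \<alpha>\<bar> * s ^ mdeg \<alpha>)) has_sum (8 / s\<^sup>2 * \<bar>t\<bar>) * M) UNIV"
        unfolding M_def by (intro has_sum_cmult_right has_sum_infsum sm)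
      have "norm ((w (p + t *\<^sub>R axis i 1) - w p) / t - D) \<le> (8 / s\<^sup>2 * \<bar>t\<bar>) * M"
      proof (rule norm_infsum_le[OF A B])
        fix \<alpha> :: "'n \<Rightarrow> nat"
        have "\<bar>(monom_at \<alpha> (x + t *\<^sub>R axis i 1) - monom_at \<alpha> x) / t
              - real (\<alpha> i) * monom_at (\<alpha>(i := \<alpha> i - 1)) x\<bar>
            \<le> real (\<alpha> i) * real (\<alpha> i - 1) * (s/2) ^ (mdeg \<alpha> - 2) * \<bar>t\<bar>"
        proof (rule monom_at_quotient_le)
          show "\<bar>x $ j\<bar> \<le> s/2" for j using xj[of j] s by linarith
          show "\<bar>x $ i + t\<bar> \<le> s/2" using xj[of i] t by linarith
        qed (use t in auto)
        also have "\<dots> \<le> 8 / s\<^sup>2 * s ^ mdeg \<alpha> * \<bar>t\<bar>"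
        proof (intro mult_right_mono)
          show "real (\<alpha> i) * real (\<alpha> i - 1) * (s/2) ^ (mdeg \<alpha> - 2) \<le> 8 / s\<^sup>2 * s ^ mdeg \<alpha>"
          proof (cases "\<alpha> i \<ge> 2")
            case True
            then have "mdeg \<alpha> \<ge> 2" by (subst mdeg_remove[of _ i]) simp
            then obtain m where m: "mdeg \<alpha> = 2 + m" using le_Suc_ex by blast
            have "real (\<alpha> i) * real (\<alpha> i - 1) \<le> 2 * 2 ^ \<alpha> i" by (rule sq_le_two_pow)
            also have "\<dots> \<le> 2 * 2 ^ mdeg \<alpha>"
              by (intro mult_left_mono power_increasing member_le_sum) auto
            finally have "real (\<alpha> i) * real (\<alpha> i - 1) * (s/2) ^ m \<le> 2 * 2 ^ (2 + m) * (s/2) ^ m"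
              using s unfolding m by (intro mult_right_mono) auto
            also have "\<dots> = 8 * (2 ^ m * (s/2) ^ m)" by (simp add: power_add)
            also have "2 ^ m * (s/2) ^ m = s ^ m" by (simp flip: power_mult_distrib)
            also have "8 * s ^ m = 8 / s\<^sup>2 * s ^ (2 + m)" using s by (simp add: power_add power2_eq_square)
            finally show ?thesis unfolding m by simp
          next
            case False
            then have "\<alpha> i = 0 \<or> \<alpha> i - 1 = 0" by linarith
            then show ?thesis using s by auto
          qed
        qed auto
        finally have "\<bar>c \<alpha>\<bar> * \<bar>(monom_at \<alpha> (x + t *\<^sub>R axis i 1) - monom_at \<alpha> x) / t
              - real (\<alpha> i) * monom_at (\<alpha>(i := \<alpha> i - 1)) x\<bar> \<le> \<bar>c \<alpha>\<bar> * (8 / s\<^sup>2 * s ^ mdeg \<alpha> * \<bar>t\<bar>)"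
          by (intro mult_left_mono) auto
        then show "norm (c \<alpha> * ((monom_at \<alpha> (x + t *\<^sub>R axis i 1) - monom_at \<alpha> x) / t
              - real (\<alpha> i) * monom_at (\<alpha>(i := \<alpha> i - 1)) x))
            \<le> (8 / s\<^sup>2 * \<bar>t\<bar>) * (\<bar>c \<alpha>\<bar> * s ^ mdeg \<alpha>)"
          unfolding real_norm_def abs_mult[of "c \<alpha>"] by (simp only: mult_ac)
      qed
      then show ?thesis by (simp add: mult_ac)
    qed
    have "((\<lambda>t. (w (p + t *\<^sub>R axis i 1) - w p) / t - D) \<longlongrightarrow> 0) (at 0)"
    proof (rule Lim_null_comparison)
      show "\<forall>\<^sub>F t in at 0. norm ((w (p + t *\<^sub>R axis i 1) - w p) / t - D) \<le> 8 * M / s\<^sup>2 * \<bar>t\<bar>"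
        unfolding eventually_at using s by (intro exI[of _ "s/4"]) (auto simp del: times_divide_eq_left intro!: bound)
      show "((\<lambda>t. 8 * M / s\<^sup>2 * \<bar>t\<bar>) \<longlongrightarrow> 0) (at 0)"
        by (intro tendsto_eq_intros) auto
    qed
    then have "((\<lambda>t. (w (p + (0 + t) *\<^sub>R axis i 1) - w (p + 0 *\<^sub>R axis i 1)) / t) \<longlongrightarrow> D) (at 0)"
      using LIM_zero_cancel by auto
    then have "((\<lambda>t. w (p + t *\<^sub>R axis i 1)) has_field_derivative D) (at 0)"
      unfolding DERIV_def by simp
    then have "partial_at i w p = D"
      unfolding partial_at_def by (rule DERIV_imp_deriv)
    with D show ?thesis by (simp add: x_def)
  qed
  with s smd show ?thesis by (auto simp: has_power_series_def)
qed

lemma scalar_analytic_at_dir_deriv: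
  assumes "scalar_analytic_at w a"
  shows "scalar_analytic_at (dir_deriv v w) a"
proof -
  have "scalar_analytic_at (partial_at i w) a" for i
    using assms has_power_series_partial unfolding scalar_analytic_at_def by blast
  then have "scalar_analytic_at (\<lambda>p. \<Sum>i\<in>UNIV. v $ i * partial_at i w p) a"
    by (intro scalar_analytic_at_sum scalar_analytic_at_cmult)
  then show ?thesis by (simp add: dir_deriv_def[abs_def] inner_vec_def)
qed

lemma strict_deriv_imp_has_derivative:
  assumes "strict_deriv f f' a"
  shows "(f has_derivative f') (at a)"
  unfolding has_derivative_within_alt
proof (intro conjI allI impI)
  show "bounded_linear f'" using assms by (simp add: strict_deriv_def)
  fix e :: real assume "e > 0"
  then obtain r where "r > 0" and r: "\<And>x y. x \<in> ball a r \<Longrightarrow> y \<in> ball a r \<Longrightarrow>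
      norm (f x - f y - f' (x - y)) \<le> e * norm (x - y)"
    using assms unfolding strict_deriv_def by meson
  then show "\<exists>d>0. \<forall>y\<in>UNIV. norm (y - a) < d \<longrightarrow> norm (f y - f a - f' (y - a)) \<le> e * norm (y - a)"
    by (intro exI[of _ r]) (auto simp: dist_norm norm_minus_commute)
qed

text \<open>The derivative given by the coefficients is made intrinsic: the chain rule along the
  axes identifies its values there with the partial derivatives, and linearity does the
  rest.\<close>

lemma scalar_analytic_at_strict_deriv:
  assumes "scalar_analytic_at w p"
  shows "strict_deriv w (\<lambda>h. dir_deriv h w p) p"
proof -
  obtain c s where "has_power_series w c s p"
    using assms by (auto simp: scalar_analytic_at_def)
  define L :: "real^'a \<Rightarrow> real" where "L = (\<lambda>h. \<Sum>i\<in>UNIV. c (\<lambda>j. if j = i then 1 else 0) * h $ i)"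
  have sd: "strict_deriv w L p"
    unfolding L_def by (rule has_power_series_strict_deriv) fact
  then have bl: "bounded_linear L" and d: "(w has_derivative L) (at p)"
    by (auto simp: strict_deriv_def intro: strict_deriv_imp_has_derivative)
  interpret bounded_linear L by fact
  have "partial_at i w p = L (axis i 1)" for i
  proof -
    have "((\<lambda>t::real. p + t *\<^sub>R axis i 1) has_derivative (\<lambda>t. t *\<^sub>R axis i 1)) (at 0)"
      by (auto intro!: derivative_eq_intros)
    from has_derivative_compose[OF this, of w L] d
    have "((\<lambda>t. w (p + t *\<^sub>R axis i 1)) has_derivative (\<lambda>t. t *\<^sub>R L (axis i 1))) (at 0)"
      by (simp add: scaleR)
    then have "((\<lambda>t. w (p + t *\<^sub>R axis i 1)) has_field_derivative L (axis i 1)) (at 0)"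
      by (simp add: has_field_derivative_def mult.commute[of "L (axis i 1)", abs_def])
    then show ?thesis unfolding partial_at_def by (rule DERIV_imp_deriv)
  qed
  then have "dir_deriv h w p = (\<Sum>i\<in>UNIV. h $ i * L (axis i 1))" for h
    by (simp add: dir_deriv_def inner_vec_def)
  also have "\<dots> h = L (\<Sum>i\<in>UNIV. h $ i *\<^sub>R axis i 1)" for h
    by (simp add: sum scaleR)
  also have "\<dots> h = L h" for h
    using basis_expansion[of h] by (simp add: scalar_mult_eq_scaleR)
  finally have "dir_deriv h w p = L h" for h .
  with sd show ?thesis by (simp add: fun_eq_iff)
qed

section \<open>Restriction of a power series to a line\<close>

lemma finite_mdeg_eq: "finite {\<alpha> :: 'n::finite \<Rightarrow> nat. mdeg \<alpha> = k}"
proof (rule finite_subset)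
  show "{\<alpha> :: 'n \<Rightarrow> nat. mdeg \<alpha> = k} \<subseteq> PiE UNIV (\<lambda>_. {..k})"
    by (auto simp: member_le_sum)
qed (auto intro: finite_PiE)

text \<open>Grouping the multi-indices by degree turns the series into one in t, whose k-th
  coefficient is the homogeneous part of degree k at v.\<close>

lemma has_power_series_line:
  assumes w: "has_power_series w c s a" and v: "\<bar>t\<bar> * norm v < s"
  shows "(\<lambda>k. (\<Sum>\<alpha> | mdeg \<alpha> = k. c \<alpha> * monom_at \<alpha> v) * t ^ k) sums w (a + t *\<^sub>R v)"
proof -
  have "a + t *\<^sub>R v \<in> ball a s" using v by (simp add: dist_norm)
  then have 1: "((\<lambda>\<alpha>. c \<alpha> * monom_at \<alpha> (t *\<^sub>R v)) has_sum w (a + t *\<^sub>R v)) UNIV"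
    using w unfolding has_power_series_def by force
  have "bij_betw snd (Sigma UNIV (\<lambda>k. {\<alpha> :: 'a \<Rightarrow> nat. mdeg \<alpha> = k})) UNIV"
    by (auto simp: bij_betw_def inj_on_def image_iff)
  then have 2: "((\<lambda>x. c (snd x) * monom_at (snd x) (t *\<^sub>R v)) has_sum w (a + t *\<^sub>R v))
      (Sigma UNIV (\<lambda>k. {\<alpha>. mdeg \<alpha> = k}))"
    using 1 by (subst has_sum_reindex_bij_betw[where g = snd]) auto
  have "((\<lambda>k. (\<Sum>\<alpha> | mdeg \<alpha> = k. c \<alpha> * monom_at \<alpha> v) * t ^ k) has_sum w (a + t *\<^sub>R v)) UNIV"
  proof (rule has_sum_SigmaD[OF 2])
    fix k
    show "((\<lambda>\<alpha>. c (snd (k, \<alpha>)) * monom_at (snd (k, \<alpha>)) (t *\<^sub>R v)) has_sum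
        (\<Sum>\<alpha> | mdeg \<alpha> = k. c \<alpha> * monom_at \<alpha> v) * t ^ k) {\<alpha>. mdeg \<alpha> = k}"
      by (rule has_sum_finiteI[OF finite_mdeg_eq])
         (auto simp: monom_at_scaleR sum_distrib_left mult_ac intro!: sum.cong)
  qed
  then show ?thesis by (rule has_sum_imp_sums)
qed

lemma scalar_analytic_at_line:
  assumes "scalar_analytic_at w a"
  obtains b r where "r > 0" "\<And>t. \<bar>t\<bar> < r \<Longrightarrow> (\<lambda>k. b k * t ^ k) sums w (a + t *\<^sub>R v)"
proof -
  obtain c s where w: "has_power_series w c s a"
    using assms by (auto simp: scalar_analytic_at_def)
  show ?thesis
  proof (rule that)
    \<comment> \<open>Dividing by \<open>norm v + 1\<close> instead of \<open>norm v\<close> also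
      covers v = 0.\<close>
    show "s / (norm v + 1) > 0" using w by (auto simp: has_power_series_def divide_pos_pos add_nonneg_pos)
    fix t assume "\<bar>t\<bar> < s / (norm v + 1)"
    then have "\<bar>t\<bar> * (norm v + 1) < s"
      by (subst (asm) pos_less_divide_eq) (auto simp: add_nonneg_pos)
    then have "\<bar>t\<bar> * norm v < s" by (simp add: distrib_left)
    with w show "(\<lambda>k. (\<Sum>\<alpha> | mdeg \<alpha> = k. c \<alpha> * monom_at \<alpha> v) * t ^ k) sums w (a + t *\<^sub>R v)"
      by (rule has_power_series_line)
  qed
qed

section \<open>Analytic functions along lines\<close>

text \<open>A nonzero coefficient of positive index would make the zero function nonzero on a
  punctured neighbourhood of 0; the constant coefficient is the value at 0.\<close>

lemma powser_eventually_zero: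
  fixes a :: "nat \<Rightarrow> real"
  assumes "\<forall>\<^sub>F t in nhds 0. (\<lambda>k. a k * t ^ k) sums 0"
  shows "a m = 0"
proof -
  obtain r where r: "r > 0" "\<And>t. \<bar>t\<bar> < r \<Longrightarrow> (\<lambda>k. a k * t ^ k) sums 0"
    using assms by (auto simp: eventually_nhds_metric dist_real_def)
  show ?thesis
  proof (cases "m = 0")
    case True
    have "(\<lambda>k. a k * 0 ^ k) sums a 0" by (rule powser_sums_zero)
    with r(2)[of 0] r(1) True show ?thesis using sums_unique2 by fastforce
  next
    case False
    show ?thesis
    proof (rule ccontr)
      assume "a m \<noteq> 0"
      show False
      proof (rule powser_0_nonzero[OF r(1), of 0 a "\<lambda>_. 0" m])
        fix s :: real
        assume "0 < s" and "\<And>z::real. z \<in> cball 0 s - {0} \<Longrightarrow> (0::real) \<noteq> 0"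
        from this(2)[of s] \<open>0 < s\<close> show False by auto
      qed (use r(2) False \<open>a m \<noteq> 0\<close> in auto)
    qed
  qed
qed

lemma scalar_analytic_at_line':
  assumes "scalar_analytic_at w a"
  shows "\<exists>b. \<forall>\<^sub>F t in nhds 0. (\<lambda>k. b k * t ^ k) sums w (a + t *\<^sub>R v)"
  using scalar_analytic_at_line[OF assms, of v]
  unfolding eventually_nhds_metric dist_real_def by (metis diff_zero)

text \<open>Zeros of a one-variable power series are isolated unless all its coefficients
  vanish.\<close>

lemma scalar_analytic_at_line_cases:
  assumes "scalar_analytic_at w p"
  shows "(\<forall>\<^sub>F t in nhds 0. w (p + t *\<^sub>R v) = 0) \<or> (\<forall>\<^sub>F t in at 0. w (p + t *\<^sub>R v) \<noteq> 0)"
proof -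
  obtain b r where r: "r > 0" and b: "\<And>t. \<bar>t\<bar> < r \<Longrightarrow> (\<lambda>k. b k * t ^ k) sums w (p + t *\<^sub>R v)"
    using scalar_analytic_at_line[OF assms, of v] by blast
  have b0: "b 0 = w p"
    using b[of 0] r powser_sums_zero[of b] sums_unique2 by fastforce
  \<comment> \<open>\<open>powser_0_nonzero\<close> requires the value 0 at the centre; a nonzero
    constant term is handled by continuity instead.\<close>
  consider "\<forall>k. b k = 0" | "b 0 \<noteq> 0" | "b 0 = 0" "\<exists>m>0. b m \<noteq> 0"
    by (metis gr0I)
  then show ?thesis
  proof cases
    case 1
    then have "w (p + t *\<^sub>R v) = 0" if "\<bar>t\<bar> < r" for t
      using b[OF that] sums_unique2[OF _ sums_zero] by simp
    then show ?thesis using r by (auto simp: eventually_nhds_metric dist_real_def)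
  next
    case 2
    have "continuous (at p) w"
      using strict_deriv_imp_has_derivative[OF scalar_analytic_at_strict_deriv[OF assms]]
      by (rule has_derivative_continuous)
    moreover have "((\<lambda>t. p + t *\<^sub>R v) \<longlongrightarrow> p) (at 0)"
      by (auto intro!: tendsto_eq_intros)
    ultimately have "((\<lambda>t. w (p + t *\<^sub>R v)) \<longlongrightarrow> w p) (at 0)"
      by (rule isCont_tendsto_compose)
    then show ?thesis using 2 b0 by (auto dest: tendsto_imp_eventually_ne)
  next
    case 3
    then obtain m where "m > 0" "b m \<noteq> 0" by blast
    then obtain s :: real where "0 < s" "\<And>t. t \<in> cball 0 s - {0} \<Longrightarrow> w (p + t *\<^sub>R v) \<noteq> 0"
      using powser_0_nonzero[OF r, of 0 b "\<lambda>t. w (p + t *\<^sub>R v)" m] b 3(1) b0 by auto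
    then show ?thesis by (auto simp: eventually_at intro!: exI[of _ s])
  qed
qed

text \<open>Identity theorem on an interval: the parameters near which w vanishes along the line
  form an open set, and at a limit point the zeros accumulate, so the dichotomy
  \<open>scalar_analytic_at_line_cases\<close> makes the set closed.\<close>

lemma analytic_zero_on_segment:
  assumes an: "\<And>t. t \<in> {0..1} \<Longrightarrow> scalar_analytic_at w (p + t *\<^sub>R v)"
    and "\<forall>\<^sub>F t in nhds 0. w (p + t *\<^sub>R v) = 0"
  shows "w (p + v) = 0"
proof -
  define E where "E = {t \<in> {0..1::real}. \<forall>\<^sub>F \<tau> in nhds t. w (p + \<tau> *\<^sub>R v) = 0}"
  have "openin (top_of_set {0..1}) E"
    unfolding openin_contains_ball
  proof (intro conjI ballI)
    fix t assume "t \<in> E"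
    then have "\<forall>\<^sub>F t in nhds t. \<forall>\<^sub>F \<tau> in nhds t. w (p + \<tau> *\<^sub>R v) = 0"
      by (simp add: E_def eventually_eventually)
    then obtain e where "e > 0" "\<forall>y. dist y t < e \<longrightarrow> (\<forall>\<^sub>F \<tau> in nhds y. w (p + \<tau> *\<^sub>R v) = 0)"
      unfolding eventually_nhds_metric by blast
    then show "\<exists>e>0. ball t e \<inter> {0..1} \<subseteq> E"
      by (intro exI[of _ e]) (auto simp: E_def dist_commute)
  qed (auto simp: E_def)
  moreover have "closedin (top_of_set {0..1}) E"
    unfolding closedin_limpt
  proof (intro conjI allI impI)
    fix t assume t: "t islimpt E \<and> t \<in> {0..1}"
    have shift: "p + t *\<^sub>R v + \<tau> *\<^sub>R v = p + (t + \<tau>) *\<^sub>R v" for \<tau>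
      by (simp add: algebra_simps)
    have "\<not> (\<forall>\<^sub>F \<tau> in at 0. w (p + (t + \<tau>) *\<^sub>R v) \<noteq> 0)"
    proof
      assume "\<forall>\<^sub>F \<tau> in at 0. w (p + (t + \<tau>) *\<^sub>R v) \<noteq> 0"
      then obtain d where d: "d > 0" "\<And>\<tau>. \<tau> \<noteq> 0 \<Longrightarrow> \<bar>\<tau>\<bar> < d \<Longrightarrow> w (p + (t + \<tau>) *\<^sub>R v) \<noteq> 0"
        by (auto simp: eventually_at dist_real_def)
      obtain t' where t': "t' \<in> E" "t' \<noteq> t" "dist t' t < d"
        using t d(1) by (auto simp: islimpt_approachable)
      from t'(1) have "w (p + t' *\<^sub>R v) = 0"
        unfolding E_def by (auto dest: eventually_nhds_x_imp_x)
      with d(2)[of "t' - t"] t' show False by (auto simp: dist_real_def)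
    qed
    then have "\<forall>\<^sub>F \<tau> in nhds 0. w (p + (t + \<tau>) *\<^sub>R v) = 0"
      using scalar_analytic_at_line_cases[OF an[of t], of v] t unfolding shift by blast
    then have "\<forall>\<^sub>F \<tau> in nhds t. w (p + \<tau> *\<^sub>R v) = 0"
      unfolding eventually_nhds_metric dist_real_def
      by (metis add.commute diff_add_cancel diff_zero)
    then show "t \<in> E" using t by (simp add: E_def)
  qed (auto simp: E_def)
  moreover have "0 \<in> E" using assms(2) by (simp add: E_def)
  ultimately have "E = {0..1}"
    using connected_clopen[of "{0..1::real}"] by auto
  then have "1 \<in> E" by auto
  then show ?thesis unfolding E_def by (auto dest: eventually_nhds_x_imp_x)
qed

section \<open>Iterated derivatives and local vanishing\<close>

primrec iter_deriv :: "(real^'n) list \<Rightarrow> (real^'n \<Rightarrow> real) \<Rightarrow> real^'n \<Rightarrow> real" where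
  "iter_deriv [] w = w"
| "iter_deriv (b # bs) w = dir_deriv b (iter_deriv bs w)"

lemma scalar_analytic_at_iter_deriv:
  "scalar_analytic_at w p \<Longrightarrow> scalar_analytic_at (iter_deriv bs w) p"
  by (induction bs) (auto intro: scalar_analytic_at_dir_deriv)

lemma dir_deriv_sum:
  "dir_deriv (\<Sum>b\<in>B. u b *\<^sub>R b) w p = (\<Sum>b\<in>B. u b * dir_deriv b w p)"
  by (simp add: dir_deriv_def inner_sum_left)

text \<open>The derivative of w along the line is given both by formal differentiation of the power
  series and by the chain rule; the two agree by uniqueness.\<close>

lemma powser_dir_deriv:
  assumes "open V" "z \<in> V" and an: "\<And>p. p \<in> V \<Longrightarrow> scalar_analytic_at w p"
    and a: "\<forall>\<^sub>F t in nhds 0. (\<lambda>k. a k * t ^ k) sums w (z + t *\<^sub>R v)"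
  shows "\<forall>\<^sub>F t in nhds 0. (\<lambda>k. diffs a k * t ^ k) sums dir_deriv v w (z + t *\<^sub>R v)"
proof -
  have "((\<lambda>t. z + t *\<^sub>R v) \<longlongrightarrow> z) (nhds 0)"
    by (auto intro!: tendsto_eq_intros filterlim_ident)
  then have "\<forall>\<^sub>F t in nhds 0. z + t *\<^sub>R v \<in> V"
    using assms(1,2) by (rule topological_tendstoD)
  with a have "\<forall>\<^sub>F t in nhds 0. (\<lambda>k. a k * t ^ k) sums w (z + t *\<^sub>R v) \<and> z + t *\<^sub>R v \<in> V"
    by (rule eventually_conj)
  then obtain r where r: "r > 0" "\<And>t. \<bar>t\<bar> < r \<Longrightarrow> (\<lambda>k. a k * t ^ k) sums w (z + t *\<^sub>R v)"
      "\<And>t. \<bar>t\<bar> < r \<Longrightarrow> z + t *\<^sub>R v \<in> V"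
    by (auto simp: eventually_nhds_metric dist_real_def)
  have "(\<lambda>k. diffs a k * t ^ k) sums dir_deriv v w (z + t *\<^sub>R v)" if t: "\<bar>t\<bar> < r" for t
  proof -
    have sm: "\<And>t. norm t < r \<Longrightarrow> summable (\<lambda>k. a k * t ^ k)"
      using r(2) by (auto simp: sums_iff)
    have 1: "((\<lambda>t. \<Sum>k. a k * t ^ k) has_field_derivative (\<Sum>k. diffs a k * t ^ k)) (at t)"
      by (rule termdiffs_strong'[OF sm]) (use t in auto)
    have "((\<lambda>t::real. z + t *\<^sub>R v) has_derivative (\<lambda>t. t *\<^sub>R v)) (at t)"
      by (auto intro!: derivative_eq_intros)
    from has_derivative_compose[OF this
        strict_deriv_imp_has_derivative[OF scalar_analytic_at_strict_deriv[OF an[OF r(3)[OF t]]]]]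
    have "((\<lambda>t. w (z + t *\<^sub>R v)) has_field_derivative dir_deriv v w (z + t *\<^sub>R v)) (at t)"
      by (simp add: has_field_derivative_def dir_deriv_def
          mult.commute[of "v \<bullet> _", abs_def])
    then have "((\<lambda>t. \<Sum>k. a k * t ^ k) has_field_derivative dir_deriv v w (z + t *\<^sub>R v)) (at t)"
      by (rule has_field_derivative_transform_within_open[where S = "ball 0 r"])
         (use t r(2) in \<open>auto simp: sums_iff\<close>)
    then have "(\<Sum>k. diffs a k * t ^ k) = dir_deriv v w (z + t *\<^sub>R v)"
      using 1 by (metis DERIV_unique)
    moreover have "summable (\<lambda>k. diffs a k * t ^ k)"
      by (rule termdiff_converges[OF _ sm]) (use t in auto)
    ultimately show ?thesis by (simp add: sums_iff)
  qed
  then show ?thesis using r(1) by (auto simp: eventually_nhds_metric dist_real_def)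
qed

text \<open>Induction on k for all lists \<open>bs\<close> at once. The derivative along v is a
  combination of those along B, so coefficient k + 1 is, up to the factor k + 1, a combination of
  the k-th coefficients of derivatives one order higher. Coefficient 0 is the value at z.\<close>

lemma powser_coeff_zero:
  assumes "open V" "z \<in> V" and an: "\<And>p. p \<in> V \<Longrightarrow> scalar_analytic_at w p"
    and "finite B" and zero: "\<And>bs. bs \<in> lists B \<Longrightarrow> iter_deriv bs w z = 0"
    and v: "v = (\<Sum>b\<in>B. u b *\<^sub>R b)"
    and "bs \<in> lists B"
    and "\<forall>\<^sub>F t in nhds 0. (\<lambda>k. a k * t ^ k) sums iter_deriv bs w (z + t *\<^sub>R v)"
  shows "a k = 0"
  using assms(7,8)
proof (induction k arbitrary: bs a)
  case 0
  have "(\<lambda>k. a k * 0 ^ k) sums iter_deriv bs w (z + 0 *\<^sub>R v)"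
    using eventually_nhds_x_imp_x[OF 0(2)] .
  then have "a 0 = iter_deriv bs w z"
    using powser_sums_zero[of a] sums_unique2 by fastforce
  then show ?case using zero[OF 0(1)] by simp
next
  case (Suc k)
  let ?W = "iter_deriv bs w"
  have "\<exists>c. \<forall>b\<in>B. \<forall>\<^sub>F t in nhds 0. (\<lambda>k. c b k * t ^ k) sums dir_deriv b ?W (z + t *\<^sub>R v)"
    using assms(2) by (intro bchoice ballI scalar_analytic_at_line' scalar_analytic_at_dir_deriv
        scalar_analytic_at_iter_deriv an)
  then obtain c where
    c: "\<And>b. b \<in> B \<Longrightarrow> \<forall>\<^sub>F t in nhds 0. (\<lambda>k. c b k * t ^ k) sums dir_deriv b ?W (z + t *\<^sub>R v)"
    by blast
  have c0: "c b k = 0" if "b \<in> B" for b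
    using Suc.IH[of "b # bs" "c b"] Suc.prems(1) that c[OF that] by auto
  have "\<forall>\<^sub>F t in nhds 0. (\<lambda>k. diffs a k * t ^ k) sums dir_deriv v ?W (z + t *\<^sub>R v)"
    by (rule powser_dir_deriv[OF assms(1,2) scalar_analytic_at_iter_deriv[OF an] Suc.prems(2)])
  moreover have "\<forall>\<^sub>F t in nhds 0. \<forall>b\<in>B. (\<lambda>k. c b k * t ^ k) sums dir_deriv b ?W (z + t *\<^sub>R v)"
    using c \<open>finite B\<close> by (simp add: eventually_ball_finite)
  \<comment> \<open>Two expansions of the same function \<open>dir_deriv v ?W\<close> along the line
    are subtracted.\<close>
  ultimately have "\<forall>\<^sub>F t in nhds 0. (\<lambda>k. (diffs a k - (\<Sum>b\<in>B. u b * c b k)) * t ^ k) sums 0"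
  proof eventually_elim
    case (elim t)
    have "(\<lambda>k. \<Sum>b\<in>B. u b * (c b k * t ^ k)) sums (\<Sum>b\<in>B. u b * dir_deriv b ?W (z + t *\<^sub>R v))"
      by (intro sums_sum sums_mult) (use elim(2) in auto)
    then have "(\<lambda>k. \<Sum>b\<in>B. u b * (c b k * t ^ k)) sums dir_deriv v ?W (z + t *\<^sub>R v)"
      unfolding v dir_deriv_sum .
    from sums_diff[OF elim(1) this] show ?case
      by (simp add: left_diff_distrib sum_distrib_right mult.assoc)
  qed
  then have "diffs a k - (\<Sum>b\<in>B. u b * c b k) = 0"
    by (rule powser_eventually_zero)
  \<comment> \<open>\<open>diffs a k\<close> is k + 1 times the coefficient of index k + 1.\<close>
  with c0 show ?case by (simp add: diffs_def)
qed

text \<open>A point y near z with y - z in the span is reached at t = 1 on the line in direction y -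
  z, along which all coefficients of w vanish.\<close>

lemma zero_near_if_iter_derivs_zero:
  assumes "open V" "z \<in> V" and an: "\<And>p. p \<in> V \<Longrightarrow> scalar_analytic_at w p"
    and "finite B" and "\<And>bs. bs \<in> lists B \<Longrightarrow> iter_deriv bs w z = 0"
  shows "\<exists>r>0. \<forall>y\<in>ball z r. y - z \<in> span B \<longrightarrow> w y = 0"
proof -
  obtain c s where w: "has_power_series w c s z"
    using an[OF \<open>z \<in> V\<close>] by (auto simp: scalar_analytic_at_def)
  have "w y = 0" if y: "y \<in> ball z s" "y - z \<in> span B" for y
  proof -
    define v where "v = y - z"
    obtain u where u: "v = (\<Sum>b\<in>B. u b *\<^sub>R b)"
      using y(2) unfolding span_finite[OF \<open>finite B\<close>] v_def by auto
    have nv: "norm v < s" using y(1) by (simp add: v_def dist_norm norm_minus_commute)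
    let ?b = "\<lambda>k. \<Sum>\<alpha> | mdeg \<alpha> = k. c \<alpha> * monom_at \<alpha> v"
    have b: "(\<lambda>k. ?b k * t ^ k) sums w (z + t *\<^sub>R v)" if "\<bar>t\<bar> \<le> 1" for t
      using that nv by (intro has_power_series_line[OF w]) (meson le_less_trans mult_left_le_one_le norm_ge_zero abs_ge_zero)
    have "\<forall>\<^sub>F t in nhds 0. (\<lambda>k. ?b k * t ^ k) sums iter_deriv [] w (z + t *\<^sub>R v)"
      unfolding eventually_nhds_metric by (intro exI[of _ 1]) (auto simp: dist_real_def intro!: b)
    then have "?b k = 0" for k
      by (intro powser_coeff_zero[OF assms u, of "[]" ?b]) auto
    with b[of 1] have "(\<lambda>k. 0) sums w (z + v)" by simp
    then show ?thesis by (simp add: v_def sums_unique2[OF _ sums_zero])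
  qed
  then show ?thesis using w by (auto simp: has_power_series_def)
qed

section \<open>The sequence of coordinate moves\<close>

text \<open>The direction i is the same for all points near z, so a sequence of moves that runs
  through I again and again must eventually use it near z.\<close>

definition thin_at :: "'n set \<Rightarrow> (real^'n) set \<Rightarrow> real^'n \<Rightarrow> bool" where
  "thin_at I K z \<longleftrightarrow> (\<exists>i\<in>I. \<exists>\<delta>>0. \<forall>x\<in>K \<inter> ball z \<delta>. \<forall>y\<in>K \<inter> ball z \<delta>.
     (\<forall>j\<in>I - {i}. x $ j = y $ j) \<longrightarrow> x = y)"

text \<open>The lower bound N serves to keep the denominators strictly increasing along the
  sequence.\<close>

lemma common_denominator:
  assumes "finite I" and "\<And>j. j \<in> I \<Longrightarrow> x j \<in> \<rat>"
  shows "\<exists>D::nat. D > N \<and> (\<forall>j\<in>I. real D * x j \<in> \<int>)"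
proof -
  have "\<exists>D::nat. D > 0 \<and> (\<forall>j\<in>I. real D * x j \<in> \<int>)"
    using assms
  proof (induction I)
    case (insert i I)
    then obtain D where D: "D > 0" "\<And>j. j \<in> I \<Longrightarrow> real D * x j \<in> \<int>" by auto
    from insert.prems[of i] obtain m :: int and n :: nat where n: "n > 0" "x i = of_int m / of_nat n"
      unfolding Rats_eq_int_div_nat by auto
    have "real (D * n) * x j \<in> \<int>" if "j \<in> insert i I" for j
    proof (cases "j = i")
      case True
      then show ?thesis using n by simp
    next
      case False
      then have "real n * (real D * x j) \<in> \<int>"
        using that by (intro Ints_mult Ints_of_nat D(2)) auto
      then show ?thesis by (simp add: mult_ac)
    qed
    then show ?case using D n by (intro exI[of _ "D * n"]) auto
  qed auto
  then obtain D where D: "D > 0" "\<forall>j\<in>I. real D * x j \<in> \<int>" by blast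
  have "real (Suc N * D) * x j \<in> \<int>" if "j \<in> I" for j
  proof -
    have "real (Suc N) * (real D * x j) \<in> \<int>" by (rule Ints_mult[OF Ints_of_nat bspec[OF D(2) that]])
    then show ?thesis by (simp only: of_nat_mult mult_ac)
  qed
  moreover have "Suc N * D > N" using D by (cases D) auto
  ultimately show ?thesis by blast
qed

lemma cyclic_enumeration:
  assumes "finite I" "I \<noteq> {}"
  obtains idx :: "nat \<Rightarrow> 'a" where "\<And>k. idx k \<in> I" "\<And>i N. i \<in> I \<Longrightarrow> \<exists>k\<ge>N. idx k = i"
proof -
  obtain h where h: "bij_betw h {0..<card I} I"
    using ex_bij_betw_nat_finite[OF assms(1)] by blast
  have c: "card I > 0" using assms by (simp add: card_gt_0_iff)
  show ?thesis
  proof (rule that[of "\<lambda>k. h (k mod card I)"])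
    show "h (k mod card I) \<in> I" for k
      using bij_betwE[OF h] c by auto
    fix i N assume "i \<in> I"
    then obtain m where m: "m < card I" "h m = i"
      using h by (metis atLeast0LessThan bij_betw_iff_bijections lessThan_iff)
    have "N \<le> m + card I * N" using c by (cases "card I") auto
    with m show "\<exists>k\<ge>N. h (k mod card I) = i"
      by (intro exI[of _ "m + card I * N"]) auto
  qed
qed

text \<open>For D k <= t < D (k + 1) the integer vectors are D k times axes in I - {idx k},
  coordinates in which D k is a denominator of x (k + 1). Replacing x (k + 1) by z costs at most f
  (D (k + 1)), which is at most f t by monotonicity.\<close>

lemma UA_I:
  fixes z :: "real^'n" and D :: "nat \<Rightarrow> nat" and idx :: "nat \<Rightarrow> 'n" and x :: "nat \<Rightarrow> real^'n"
  assumes g: "g \<le> card I - 1" and idx: "\<And>k. idx k \<in> I"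
    and f: "antimono_on {0<..} f"
    and D: "\<And>k. 0 < D k" "\<And>k. D k < D (Suc k)"
    and int: "\<And>k j. j \<in> I - {idx k} \<Longrightarrow> real (D k) * x (Suc k) $ j \<in> \<int>"
    and z: "\<And>k. real (D (Suc k)) * dist (x (Suc k)) z \<le> f (D (Suc k))"
  shows "z \<in> UA f g"
  unfolding UA_def mem_Collect_eq
proof (rule eventually_at_top_linorderI[of "real (D 0)"])
  fix t assume t: "real (D 0) \<le> t"
  have mono: "strict_mono D" using D(2) by (simp add: strict_mono_Suc_iff)
  obtain N where "t < real N" using reals_Archimedean2 by blast
  also have "\<dots> \<le> real (D N)" using seq_suble[OF mono] by simp
  finally have ex: "\<exists>m. t < real (D m)" by blast
  \<comment> \<open>This index is positive because D 0 <= t, so its predecessor k satisfies D k <=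
    t.\<close>
  define m where "m = (LEAST m. t < real (D m))"
  have m: "t < real (D m)" unfolding m_def using ex by (rule LeastI_ex)
  then have "m \<noteq> 0" using t by (metis linorder_not_less)
  then obtain k where k: "m = Suc k" using not0_implies_Suc by blast
  have Dk: "real (D k) \<le> t"
    using not_less_Least[of k "\<lambda>m. t < real (D m)"] k by (auto simp: m_def[symmetric])
  have t0: "t > 0" using D(1)[of k] Dk by linarith
  \<comment> \<open>Here g <= card I - 1 enters: there is room for g distinct coordinates other than
    \<open>idx k\<close>.\<close>
  have "card {1..g} \<le> card (I - {idx k})" using g idx by simp
  then obtain h where h: "h ` {1..g} \<subseteq> I - {idx k}" "inj_on h {1..g}"
    using card_le_inj[of "{1..g}" "I - {idx k}"] by auto
  define q where "q i = real (D k) *\<^sub>R (axis (h i) 1 :: real^'n)" for i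
  define p where "p i = \<lfloor>real (D k) * x (Suc k) $ h i\<rfloor>" for i
  have D0: "real (D k) \<noteq> 0" using D(1)[of k] by simp
  show "\<exists>(q :: nat \<Rightarrow> real^'n) (p :: nat \<Rightarrow> int). inj_on q {1..g} \<and> independent (q ` {1..g}) \<and>
     (\<forall>i\<in>{1..g}. (\<forall>j. q i $ j \<in> \<int>) \<and> infnorm (q i) \<le> t \<and> \<bar>q i \<bullet> z - of_int (p i)\<bar> \<le> f t)"
  proof (intro exI[of _ q] exI[of _ p] conjI ballI allI)
    show "inj_on q {1..g}"
    proof (rule inj_onI)
      fix a b assume ab: "a \<in> {1..g}" "b \<in> {1..g}" "q a = q b"
      then have "axis (h a) 1 = (axis (h b) 1 :: real^'n)" using D0 by (simp add: q_def)
      then have "h a = h b" by (simp add: axis_eq_axis)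
      with h(2) ab show "a = b" by (auto dest: inj_onD)
    qed
    show "independent (q ` {1..g})"
    proof (rule pairwise_orthogonal_independent)
      show "pairwise orthogonal (q ` {1..g})"
        by (auto simp: pairwise_def orthogonal_def q_def inner_axis_axis)
      show "0 \<notin> q ` {1..g}" using D0 by (auto simp: q_def axis_eq_0_iff)
    qed
    fix i assume i: "i \<in> {1..g}"
    show "q i $ j \<in> \<int>" for j by (simp add: q_def axis_def)
    have "infnorm (q i) \<le> norm (q i)" by (rule infnorm_le_norm)
    then show "infnorm (q i) \<le> t" using Dk by (simp add: q_def norm_axis_1)
    have hi: "h i \<in> I - {idx k}" using h(1) i by blast
    have "of_int (p i) = real (D k) * x (Suc k) $ h i"
      unfolding p_def using int[OF hi] by simp
    then have "\<bar>q i \<bullet> z - of_int (p i)\<bar> = real (D k) * \<bar>(x (Suc k) - z) $ h i\<bar>"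
      by (simp add: q_def inner_axis' abs_mult flip: right_diff_distrib) (simp add: abs_minus_commute)
    also have "\<dots> \<le> real (D (Suc k)) * dist (x (Suc k)) z"
      unfolding dist_norm
      by (intro mult_mono component_le_norm_cart) (use D(2)[of k] in auto)
    also have "\<dots> \<le> f (D (Suc k))" by (rule z)
    also have "\<dots> \<le> f t"
      using f t0 m unfolding k by (auto simp: monotone_on_def)
    finally show "\<bar>q i \<bullet> z - of_int (p i)\<bar> \<le> f t" .
  qed
qed

text \<open>The limiting construction, with the geometry of Y reduced to closedness near x0 and the
  existence of arbitrarily small moves to a rational value in one coordinate.\<close>

lemma UA_point_avoiding_thin_sets:
  fixes Y :: "(real^'n) set" and f :: "real \<Rightarrow> real"
  assumes g: "1 \<le> g" "g \<le> card I - 1"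
    and f: "\<And>t. t > 0 \<Longrightarrow> f t > 0" "antimono_on {0<..} f"
    and Y: "x0 \<in> Y" "closed (Y \<inter> cball x0 \<rho>)" and "\<rho> > 0"
    and move: "\<And>x i \<epsilon>. x \<in> Y \<inter> ball x0 \<rho> \<Longrightarrow> i \<in> I \<Longrightarrow> \<epsilon> > 0 \<Longrightarrow>
       \<exists>y\<in>Y. y \<noteq> x \<and> dist y x < \<epsilon> \<and> (\<forall>j\<in>I - {i}. y $ j = x $ j) \<and> y $ i \<in> \<rat>"
    and "countable \<K>"
    and cl: "\<And>K x. K \<in> \<K> \<Longrightarrow> x \<in> Y \<inter> ball x0 \<rho> \<Longrightarrow> x \<notin> K \<Longrightarrow> \<exists>\<epsilon>>0. ball x \<epsilon> \<inter> Y \<inter> K = {}"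
  shows "\<exists>z\<in>Y \<inter> cball x0 \<rho>. z \<in> UA f g \<and> (\<forall>K\<in>\<K>. z \<in> K \<longrightarrow> \<not> thin_at I K z)"
proof -
  have "I \<noteq> {}" using g by auto
  then obtain idx where idx: "\<And>k::nat. idx k \<in> I" "\<And>i N. i \<in> I \<Longrightarrow> \<exists>k\<ge>N. idx k = i"
    using cyclic_enumeration[of I] by auto
  \<comment> \<open>Inserting the empty set makes the family nonempty, so that it can be enumerated
    by the natural numbers.\<close>
  define K where "K = from_nat_into (insert {} \<K>)"
  have ranK: "range K = insert {} \<K>"
    unfolding K_def using \<open>countable \<K>\<close> by (intro range_from_nat_into) auto
  have clK: "\<exists>\<epsilon>>0. ball x \<epsilon> \<inter> Y \<inter> K l = {}" if "x \<in> Y \<inter> ball x0 \<rho>" "x \<notin> K l" for x l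
  proof (cases "K l = {}")
    case False
    then have "K l \<in> \<K>" using ranK by blast
    then show ?thesis using cl that by blast
  qed (auto intro: exI[of _ 1])
  \<comment> \<open>A state consists of the current point, the radius of the ball that contains all later points,
    and a common denominator of the coordinates in \<open>I\<close>.\<close>
  define P where "P k s \<longleftrightarrow> (case s of (x, \<epsilon>, D) \<Rightarrow> x \<in> Y \<and> 0 < \<epsilon> \<and> \<epsilon> \<le> inverse (real (Suc k)) \<and>
      dist x0 x + \<epsilon> < \<rho> \<and> (\<forall>j\<in>I. x $ j \<in> \<rat> \<and> real D * x $ j \<in> \<int>) \<and> 0 < D \<and> real D * \<epsilon> \<le> f D \<and>
      (\<forall>l\<le>k. x \<notin> K l \<longrightarrow> cball x \<epsilon> \<inter> Y \<inter> K l = {}))"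
    for k :: nat and s :: "(real^'n) \<times> real \<times> nat"
  \<comment> \<open>Consecutive points differ, which is what contradicts thinness at the end. Nested
    balls keep all later points and the limit in the current ball.\<close>
  define Q where "Q k s s' \<longleftrightarrow> (case s of (x, \<epsilon>, D) \<Rightarrow> case s' of (x', \<epsilon>', D') \<Rightarrow>
      x' \<noteq> x \<and> (\<forall>j\<in>I - {idx k}. x' $ j = x $ j) \<and> cball x' \<epsilon>' \<subseteq> cball x \<epsilon> \<and> D < D')"
    for k :: nat and s s' :: "(real^'n) \<times> real \<times> nat"
  have extend: "\<exists>\<epsilon> D. P k (x, \<epsilon>, D) \<and> \<epsilon> \<le> \<eta> \<and> N < D"
    if x: "x \<in> Y \<inter> ball x0 \<rho>" "\<And>j. j \<in> I \<Longrightarrow> x $ j \<in> \<rat>" and "\<eta> > 0" for x k \<eta> N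
  proof -
    obtain D where D: "N < D" "\<forall>j\<in>I. real D * x $ j \<in> \<int>"
      using common_denominator[of I "\<lambda>j. x $ j" N] x(2) by auto
    have D0: "D > 0" using D by linarith
    have "\<forall>l. \<exists>e>0. x \<notin> K l \<longrightarrow> ball x e \<inter> Y \<inter> K l = {}"
      using clK[OF x(1)] zero_less_one by blast
    then obtain e where e: "\<And>l. e l > (0::real)" "\<And>l. x \<notin> K l \<Longrightarrow> ball x (e l) \<inter> Y \<inter> K l = {}"
      by metis
    define \<mu> where "\<mu> = Min (e ` {..k})"
    have \<mu>: "\<mu> > 0" "\<And>l. l \<le> k \<Longrightarrow> \<mu> \<le> e l"
      unfolding \<mu>_def using e(1) by auto
    \<comment> \<open>The five bounds serve, in order, nesting of the balls, convergence to the
      limit, staying inside the ball around x0, the approximation quality at denominator D, and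
      avoidance of the first k + 1 sets. The last is halved to fit a closed ball into an open
      one.\<close>
    define \<epsilon> where "\<epsilon> = Min {\<eta>, inverse (real (Suc k)), (\<rho> - dist x0 x) / 2, f D / D, \<mu> / 2}"
    have \<epsilon>: "\<epsilon> \<le> \<eta>" "\<epsilon> \<le> inverse (real (Suc k))" "\<epsilon> \<le> (\<rho> - dist x0 x) / 2" "\<epsilon> \<le> f D / D" "\<epsilon> \<le> \<mu> / 2"
      unfolding \<epsilon>_def by (intro Min_le; simp)+
    have "\<epsilon> > 0"
      unfolding \<epsilon>_def using \<open>\<eta> > 0\<close> x(1) f(1)[of "real D"] D0 \<mu>(1) by (subst Min_gr_iff) auto
    have "cball x \<epsilon> \<inter> Y \<inter> K l = {}" if "l \<le> k" "x \<notin> K l" for l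
    proof -
      have "cball x \<epsilon> \<subseteq> ball x (e l)" using \<epsilon>(5) \<mu>(1) \<mu>(2)[OF that(1)] by auto
      then show ?thesis using e(2)[OF that(2)] by blast
    qed
    moreover have "real D * \<epsilon> \<le> f D" using \<epsilon>(4) D0 by (simp add: field_simps)
    moreover have "dist x0 x + \<epsilon> < \<rho>" using \<epsilon>(3) x(1) by simp
    ultimately have "P k (x, \<epsilon>, D)"
      unfolding P_def using x D D0 \<epsilon> \<open>\<epsilon> > 0\<close> by auto
    then show ?thesis using \<epsilon>(1) D(1) by blast
  qed
  \<comment> \<open>One move per coordinate makes the coordinates in I rational one after another;
    each move leaves the earlier ones untouched.\<close>
  have start: "\<exists>x\<in>Y \<inter> ball x0 \<rho>. \<forall>j\<in>J. x $ j \<in> \<rat>" if "J \<subseteq> I" for J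
    using finite[of J] that
  proof (induction J)
    case empty
    then show ?case using Y \<open>\<rho> > 0\<close> by auto
  next
    case (insert i J)
    then obtain x where x: "x \<in> Y \<inter> ball x0 \<rho>" "\<forall>j\<in>J. x $ j \<in> \<rat>" by auto
    have "i \<in> I" "\<rho> - dist x0 x > 0" using insert x(1) by auto
    from move[OF x(1) this] obtain y where y: "y \<in> Y" "dist y x < \<rho> - dist x0 x"
      "\<forall>j\<in>I - {i}. y $ j = x $ j" "y $ i \<in> \<rat>" by blast
    have "y \<in> ball x0 \<rho>" using y(2) dist_triangle[of x0 y x] by (simp add: dist_commute)
    moreover have "y $ j \<in> \<rat>" if "j \<in> insert i J" for j
      using that y(3,4) x(2) insert.hyps(2) insert.prems by (cases "j = i") (auto simp: subset_iff)
    ultimately show ?case using y(1) by blast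
  qed
  obtain x1 where x1: "x1 \<in> Y \<inter> ball x0 \<rho>" "\<And>j. j \<in> I \<Longrightarrow> x1 $ j \<in> \<rat>"
    using start[OF subset_refl] by blast
  have "\<exists>s. P 0 s"
    using extend[OF x1 zero_less_one] by blast
  moreover have "\<exists>s'. P (Suc k) s' \<and> Q k s s'" if "P k s" for k s
  proof -
    obtain x \<epsilon> D where s: "s = (x, \<epsilon>, D)" by (cases s)
    have x: "x \<in> Y \<inter> ball x0 \<rho>" "\<epsilon> > 0" "dist x0 x + \<epsilon> < \<rho>" "\<And>j. j \<in> I \<Longrightarrow> x $ j \<in> \<rat>"
      using that by (auto simp: P_def s)
    \<comment> \<open>Moving by less than \<epsilon> / 2 and choosing the next radius at most
      \<epsilon> / 2 keeps the new closed ball inside the old one.\<close>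
    from move[OF x(1) idx(1)[of k], of "\<epsilon>/2"] \<open>\<epsilon> > 0\<close> obtain y where
      y: "y \<in> Y" "y \<noteq> x" "dist y x < \<epsilon>/2" "\<And>j. j \<in> I - {idx k} \<Longrightarrow> y $ j = x $ j" "y $ idx k \<in> \<rat>"
      by auto
    have y1: "y \<in> Y \<inter> ball x0 \<rho>"
      using y(1,3) x(2,3) dist_triangle[of x0 y x] by (simp add: dist_commute)
    have y2: "y $ j \<in> \<rat>" if "j \<in> I" for j
      using that y(4)[of j] y(5) x(4)[of j] by (cases "j = idx k") auto
    obtain \<epsilon>' D' where "P (Suc k) (y, \<epsilon>', D')" "\<epsilon>' \<le> \<epsilon>/2" "D < D'"
      using extend[OF y1 y2, of "\<epsilon>/2" "Suc k" D] \<open>\<epsilon> > 0\<close> by auto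
    moreover from this have "cball y \<epsilon>' \<subseteq> cball x \<epsilon>"
      using y(3) by (subst cball_subset_cball_iff) auto
    ultimately show ?thesis
      using y by (intro exI[of _ "(y, \<epsilon>', D')"]) (auto simp: Q_def s)
  qed
  ultimately obtain s where s: "\<And>k. P k (s k) \<and> Q k (s k) (s (Suc k))"
    using dependent_nat_choice[of P Q] by blast
  define x \<epsilon> D where "x k = fst (s k)" and "\<epsilon> k = fst (snd (s k))" and "D k = snd (snd (s k))" for k
  have seq: "s k = (x k, \<epsilon> k, D k)" for k by (simp add: x_def \<epsilon>_def D_def)
  note P = s[THEN conjunct1, unfolded P_def seq prod.case]
  note Q = s[THEN conjunct2, unfolded Q_def seq prod.case]
  define C where "C k = Y \<inter> cball (x k) (\<epsilon> k)" for k
  have sub: "cball (x k) (\<epsilon> k) \<subseteq> cball x0 \<rho>" for k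
    using P[of k] by (subst cball_subset_cball_iff) (auto simp: dist_commute)
  have anti: "C n \<subseteq> C m" if "m \<le> n" for m n
    by (rule lift_Suc_antimono_le[OF _ that]) (use Q in \<open>auto simp: C_def\<close>)
  \<comment> \<open>All balls lie in \<open>cball x0 \<rho>\<close>, where Y is closed, so the
    nested sets \<open>C k\<close> are compact although Y need not be closed globally.\<close>
  have "\<Inter>(range C) \<noteq> {}"
  proof (rule compact_nest)
    fix k
    have "C k = (Y \<inter> cball x0 \<rho>) \<inter> cball (x k) (\<epsilon> k)" using sub[of k] by (auto simp: C_def)
    then show "compact (C k)" using Y(2) by (simp add: closed_Int_compact)
    have "x k \<in> C k" using P[of k] by (simp add: C_def)
    then show "C k \<noteq> {}" by blast
  qed (use anti in auto)
  then obtain z where z: "\<And>k. z \<in> C k" by blast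
  then have zY: "z \<in> Y" and dz: "\<And>k. dist (x k) z \<le> \<epsilon> k" by (auto simp: C_def)
  have "z \<in> UA f g"
  proof (rule UA_I[OF g(2) idx(1) f(2)])
    fix k
    show "0 < D k" "D k < D (Suc k)" using P[of k] Q[of k] by auto
    show "real (D k) * x (Suc k) $ j \<in> \<int>" if "j \<in> I - {idx k}" for j
      using P[of k] Q[of k] that by auto
    have "real (D (Suc k)) * dist (x (Suc k)) z \<le> real (D (Suc k)) * \<epsilon> (Suc k)"
      using dz by (intro mult_left_mono) auto
    then show "real (D (Suc k)) * dist (x (Suc k)) z \<le> f (D (Suc k))"
      using P[of "Suc k"] by linarith
  qed
  moreover have "\<not> thin_at I L z" if "L \<in> \<K>" "z \<in> L" for L
  proof
    assume "thin_at I L z"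
    then obtain i \<delta> where i: "i \<in> I" "\<delta> > 0" and
      thin: "\<And>x y. x \<in> L \<inter> ball z \<delta> \<Longrightarrow> y \<in> L \<inter> ball z \<delta> \<Longrightarrow> \<forall>j\<in>I - {i}. x $ j = y $ j \<Longrightarrow> x = y"
      unfolding thin_at_def by meson
    have "L \<in> range K" using that(1) ranK by blast
    then obtain l where l: "L = K l" by blast
    obtain N where N: "inverse (real (Suc N)) < \<delta>" using reals_Archimedean[OF \<open>\<delta> > 0\<close>] by blast
    \<comment> \<open>From index max l N on, the set K l is taken into account and the radii are
      below \<delta>. Among these indices there is one at which coordinate i is moved.\<close>
    obtain k where k: "k \<ge> max l N" "idx k = i" using idx(2)[OF i(1)] by blast
    \<comment> \<open>The ball around x m contains z, which lies in Y and in K l. The avoidance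
      clause of \<open>P\<close> therefore forces x m into K l.\<close>
    have mem: "x m \<in> L \<inter> ball z \<delta>" if "m \<ge> max l N" for m
    proof -
      have "cball (x m) (\<epsilon> m) \<inter> Y \<inter> K l \<noteq> {}" using z[of m] that(1) \<open>z \<in> L\<close> by (auto simp: C_def l)
      then have "x m \<in> K l" using P[of m] that by auto
      moreover have "inverse (real (Suc m)) \<le> inverse (real (Suc N))" using that by simp
      then have "dist (x m) z < \<delta>" using dz[of m] P[of m] N by linarith
      ultimately show ?thesis by (simp add: l dist_commute)
    qed
    have "x (Suc k) = x k"
      by (rule thin) (use mem[of k] mem[of "Suc k"] k Q[of k] in auto)
    then show False using Q[of k] by blast
  qed
  moreover have "z \<in> cball x0 \<rho>" using z[of 0] sub[of 0] by (auto simp: C_def)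
  ultimately show ?thesis using zY by blast
qed

section \<open>Coordinate projections and strict derivatives\<close>

definition proj_on :: "'n set \<Rightarrow> real^'n \<Rightarrow> real^'n" where
  "proj_on I x = (\<chi> i. if i \<in> I then x $ i else 0)"

lemma proj_on_nth [simp]: "proj_on I x $ i = (if i \<in> I then x $ i else 0)"
  by (simp add: proj_on_def)

lemma linear_proj_on: "linear (proj_on I)"
  by (rule linearI) (auto simp: vec_eq_iff)

lemma bounded_linear_proj_on: "bounded_linear (proj_on I)"
  using linear_proj_on by (simp add: linear_conv_bounded_linear)

definition coord_subspace :: "'n set \<Rightarrow> (real^'n) set" where
  "coord_subspace I = {x. \<forall>j. j \<notin> I \<longrightarrow> x $ j = 0}"

lemma subspace_coord_subspace: "subspace (coord_subspace I)"
  by (auto simp: subspace_def coord_subspace_def)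

lemma proj_on_in_coord_subspace [simp]: "proj_on I x \<in> coord_subspace I"
  by (auto simp: coord_subspace_def)

lemma independent_axes: "independent ((\<lambda>i. axis i 1 :: real^'n) ` I)"
proof (rule pairwise_orthogonal_independent)
  show "pairwise orthogonal ((\<lambda>i. axis i 1 :: real^'n) ` I)"
    by (auto simp: pairwise_def orthogonal_def inner_axis_axis)
qed (auto simp: axis_eq_0_iff)

lemma card_axes: "card ((\<lambda>i. axis i 1 :: real^'n) ` I) = card I"
  by (intro card_image inj_onI) (simp add: axis_eq_axis)

lemma dim_coord_subspace: "dim (coord_subspace I :: (real^'n) set) = card I"
proof (rule dim_unique)
  show "(\<lambda>i. axis i 1) ` I \<subseteq> coord_subspace I"
    by (auto simp: coord_subspace_def axis_def)
  show "coord_subspace I \<subseteq> span ((\<lambda>i. axis i 1 :: real^'n) ` I)"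
  proof
    fix x :: "real^'n" assume x: "x \<in> coord_subspace I"
    have "x = (\<Sum>i\<in>UNIV. x $ i *\<^sub>R axis i 1)"
      using basis_expansion[of x] by (simp add: scalar_mult_eq_scaleR)
    also have "\<dots> = (\<Sum>i\<in>I. x $ i *\<^sub>R axis i 1)"
      using x by (intro sum.mono_neutral_right) (auto simp: coord_subspace_def)
    also have "\<dots> \<in> span ((\<lambda>i. axis i 1 :: real^'n) ` I)"
      by (intro span_sum span_scale span_base) auto
    finally show "x \<in> span ((\<lambda>i. axis i 1 :: real^'n) ` I)" .
  qed
qed (rule independent_axes card_axes)+

lemma proj_on_injective_dim_le:
  assumes "subspace W" "\<And>w. w \<in> W \<Longrightarrow> proj_on I w = 0 \<Longrightarrow> w = 0"
  shows "dim W \<le> card I"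
proof -
  have "inj_on (proj_on I) W"
    using assms linear_injective_on_subspace_0[OF linear_proj_on] by blast
  then have "dim W = dim (proj_on I ` W)"
    using assms(1) by (metis dim_image_eq linear_proj_on span_eq_iff)
  also have "\<dots> \<le> dim (coord_subspace I)" by (intro dim_subset) auto
  finally show ?thesis by (simp add: dim_coord_subspace)
qed

text \<open>By dimension the projection of W misses the axis of some i in I. A vector w of W whose
  coordinates in I - {i} vanish projects to w $ i times that axis, so w $ i = 0.\<close>

lemma proj_on_drop_coordinate:
  fixes W :: "(real^'n) set"
  assumes W: "subspace W" and inj: "\<And>w. w \<in> W \<Longrightarrow> proj_on I w = 0 \<Longrightarrow> w = 0"
    and "dim W < card I"
  obtains i where "i \<in> I" "\<And>w. w \<in> W \<Longrightarrow> proj_on (I - {i}) w = 0 \<Longrightarrow> w = 0"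
proof -
  have "\<exists>i\<in>I. axis i 1 \<notin> proj_on I ` W"
  proof (rule ccontr)
    assume "\<not> (\<exists>i\<in>I. axis i 1 \<notin> proj_on I ` W)"
    then have "card ((\<lambda>i. axis i 1 :: real^'n) ` I) \<le> dim (proj_on I ` W)"
      by (intro independent_card_le_dim independent_axes) auto
    also have "\<dots> \<le> dim W" by (rule dim_image_le[OF linear_proj_on])
    finally show False using assms(3) by (simp add: card_axes)
  qed
  then obtain i where i: "i \<in> I" "axis i 1 \<notin> proj_on I ` W" by blast
  have "w = 0" if w: "w \<in> W" "proj_on (I - {i}) w = 0" for w
  proof -
    have 0: "w $ j = 0" if "j \<in> I - {i}" for j
      using w(2) that by (auto simp: vec_eq_iff split: if_splits)
    have "w $ i = 0"
    proof (rule ccontr)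
      assume nz: "w $ i \<noteq> 0"
      have "proj_on I (inverse (w $ i) *\<^sub>R w) = axis i 1"
        using nz 0 i(1) by (auto simp: vec_eq_iff axis_def)
      moreover have "inverse (w $ i) *\<^sub>R w \<in> W" using W w(1) by (rule subspace_scale)
      ultimately show False using i(2) by (metis imageI)
    qed
    then have "proj_on I w = 0" using 0 by (auto simp: vec_eq_iff)
    with inj w(1) show ?thesis by blast
  qed
  with i(1) that show ?thesis by blast
qed

text \<open>A set I of least size with injective projection works: if it had more than dim W
  elements, one of them could be dropped.\<close>

lemma proj_on_injective_exists:
  fixes W :: "(real^'n) set"
  assumes W: "subspace W"
  obtains I where "card I = dim W" "\<And>w. w \<in> W \<Longrightarrow> proj_on I w = 0 \<Longrightarrow> w = 0"
proof -
  let ?P = "\<lambda>I. \<forall>w\<in>W. proj_on I w = 0 \<longrightarrow> w = 0"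
  have "?P UNIV" by (auto simp: vec_eq_iff)
  then have "\<exists>I. ?P I \<and> (\<forall>J. ?P J \<longrightarrow> card I \<le> card J)"
    by (rule ex_has_least_nat)
  then obtain I where I: "?P I" and min: "\<forall>J. ?P J \<longrightarrow> card I \<le> card J"
    by (elim exE conjE)
  have "\<not> dim W < card I"
  proof
    assume "dim W < card I"
    obtain i where i: "i \<in> I" "?P (I - {i})"
      by (rule proj_on_drop_coordinate[OF W, of I]) (use I \<open>dim W < card I\<close> in auto)
    have "card (I - {i}) < card I" using i(1) by (intro psubset_card_mono) auto
    moreover have "card I \<le> card (I - {i})" using min i(2) by (elim allE impE)
    ultimately show False by simp
  qed
  moreover have "dim W \<le> card I" using proj_on_injective_dim_le[OF W] I by blast
  ultimately show ?thesis using that I by simp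
qed

section \<open>Calculus of strict derivatives\<close>

lemma strict_deriv_bounded_linear: "strict_deriv f f' a \<Longrightarrow> bounded_linear f'"
  by (simp add: strict_deriv_def)

lemma strict_derivD:
  assumes "strict_deriv f f' a" "e > 0"
  obtains r where "r > 0" "\<And>x y. x \<in> ball a r \<Longrightarrow> y \<in> ball a r \<Longrightarrow>
      norm (f x - f y - f' (x - y)) \<le> e * norm (x - y)"
  using assms unfolding strict_deriv_def by meson

lemma strict_deriv_lipschitz:
  assumes "strict_deriv f f' a"
  obtains C r where "C > 0" "r > 0" "\<And>x y. x \<in> ball a r \<Longrightarrow> y \<in> ball a r \<Longrightarrow>
      norm (f x - f y) \<le> C * norm (x - y)"
proof -
  obtain B where B: "B > 0" "\<And>x. norm (f' x) \<le> norm x * B"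
    using bounded_linear.pos_bounded[OF strict_deriv_bounded_linear[OF assms]] by blast
  obtain r where r: "r > 0" "\<And>x y. x \<in> ball a r \<Longrightarrow> y \<in> ball a r \<Longrightarrow>
      norm (f x - f y - f' (x - y)) \<le> 1 * norm (x - y)"
    using strict_derivD[OF assms, of 1] by auto
  have "norm (f x - f y) \<le> (B + 1) * norm (x - y)" if "x \<in> ball a r" "y \<in> ball a r" for x y
    using r(2)[OF that] B(2)[of "x - y"] norm_triangle_sub[of "f x - f y" "f' (x - y)"]
    by (simp add: algebra_simps)
  then show ?thesis using that[of "B + 1" r] B r by auto
qed

text \<open>A linear map injective on the finite-dimensional space T is bounded below there by some
  e; a strict error of e / 2 leaves half of this bound. Only the difference of the two points has to
  lie in T.\<close>

lemma strict_deriv_bounded_below: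
  fixes f :: "'a::euclidean_space \<Rightarrow> 'b::euclidean_space"
  assumes f: "strict_deriv f f' a" and T: "subspace T"
    and inj: "\<And>v. v \<in> T \<Longrightarrow> f' v = 0 \<Longrightarrow> v = 0"
  obtains c r where "c > 0" "r > 0" "\<And>x y. x \<in> ball a r \<Longrightarrow> y \<in> ball a r \<Longrightarrow> x - y \<in> T \<Longrightarrow>
      norm (x - y) \<le> c * norm (f x - f y)"
proof -
  obtain e where e: "e > 0" "\<And>v. v \<in> T \<Longrightarrow> e * norm v \<le> norm (f' v)"
    using injective_imp_isometric[OF closed_subspace[OF T] T strict_deriv_bounded_linear[OF f]] inj
    by blast
  obtain r where r: "r > 0" "\<And>x y. x \<in> ball a r \<Longrightarrow> y \<in> ball a r \<Longrightarrow>
      norm (f x - f y - f' (x - y)) \<le> (e / 2) * norm (x - y)"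
    using strict_derivD[OF f, of "e/2"] e(1) by auto
  have "norm (x - y) \<le> (2 / e) * norm (f x - f y)"
    if "x \<in> ball a r" "y \<in> ball a r" "x - y \<in> T" for x y
  proof -
    have "e * norm (x - y) \<le> norm (f' (x - y))" using that(3) by (rule e)
    also have "\<dots> \<le> norm (f x - f y) + norm (f x - f y - f' (x - y))"
      using norm_triangle_sub[of "f' (x - y)" "f x - f y"] by (simp add: norm_minus_commute)
    also have "\<dots> \<le> norm (f x - f y) + (e / 2) * norm (x - y)"
      using r(2)[OF that(1,2)] by simp
    finally show ?thesis using e(1) by (simp add: field_simps)
  qed
  then show ?thesis using that[of "2 / e" r] e r by auto
qed

lemma strict_deriv_linear_compose:
  assumes f: "strict_deriv f f' a" and "bounded_linear p"
  shows "strict_deriv (\<lambda>x. p (f x)) (\<lambda>x. p (f' x)) a"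
  unfolding strict_deriv_def
proof (intro conjI allI impI)
  interpret p: bounded_linear p by fact
  show "bounded_linear (\<lambda>x. p (f' x))"
    using assms strict_deriv_bounded_linear bounded_linear_compose by blast
  fix e :: real assume "e > 0"
  obtain B where B: "B > 0" "\<And>x. norm (p x) \<le> norm x * B"
    using p.pos_bounded by blast
  obtain r where r: "r > 0" "\<And>x y. x \<in> ball a r \<Longrightarrow> y \<in> ball a r \<Longrightarrow>
      norm (f x - f y - f' (x - y)) \<le> (e / B) * norm (x - y)"
    using strict_derivD[OF f, of "e/B"] \<open>e > 0\<close> B(1) by auto
  have "norm (p (f x) - p (f y) - p (f' (x - y))) \<le> e * norm (x - y)"
    if "x \<in> ball a r" "y \<in> ball a r" for x y
  proof -
    have "norm (p (f x) - p (f y) - p (f' (x - y))) = norm (p (f x - f y - f' (x - y)))"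
      by (simp add: p.diff)
    also have "\<dots> \<le> norm (f x - f y - f' (x - y)) * B" by (rule B(2))
    also have "\<dots> \<le> ((e / B) * norm (x - y)) * B"
      using r(2)[OF that] B(1) by (intro mult_right_mono) auto
    finally show ?thesis using B(1) by simp
  qed
  then show "\<exists>r>0. \<forall>x\<in>ball a r. \<forall>y\<in>ball a r.
      norm (p (f x) - p (f y) - p (f' (x - y))) \<le> e * norm (x - y)"
    using r(1) by blast
qed

lemma strict_deriv_Pair:
  assumes f: "strict_deriv f f' a" and g: "strict_deriv g g' a"
  shows "strict_deriv (\<lambda>x. (f x, g x)) (\<lambda>x. (f' x, g' x)) a"
  unfolding strict_deriv_def
proof (intro conjI allI impI)
  show "bounded_linear (\<lambda>x. (f' x, g' x))"
    by (intro bounded_linear_Pair strict_deriv_bounded_linear[OF f] strict_deriv_bounded_linear[OF g])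
  fix e :: real assume "e > 0"
  then have "e / 2 > 0" by simp
  obtain r where
    r: "r > 0" "\<And>x y. x \<in> ball a r \<Longrightarrow> y \<in> ball a r \<Longrightarrow>
      norm (f x - f y - f' (x - y)) \<le> (e / 2) * norm (x - y)"
    by (rule strict_derivD[OF f \<open>e / 2 > 0\<close>]) blast
  obtain s where
    s: "s > 0" "\<And>x y. x \<in> ball a s \<Longrightarrow> y \<in> ball a s \<Longrightarrow>
      norm (g x - g y - g' (x - y)) \<le> (e / 2) * norm (x - y)"
    by (rule strict_derivD[OF g \<open>e / 2 > 0\<close>]) blast
  have "norm ((f x, g x) - (f y, g y) - (f' (x - y), g' (x - y))) \<le> e * norm (x - y)"
    if "x \<in> ball a (min r s)" "y \<in> ball a (min r s)" for x y
    using r(2)[of x y] s(2)[of x y] that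
      norm_Pair_le[of "f x - f y - f' (x - y)" "g x - g y - g' (x - y)"]
    unfolding diff_Pair by auto
  then show "\<exists>r>0. \<forall>x\<in>ball a r. \<forall>y\<in>ball a r.
      norm ((f x, g x) - (f y, g y) - (f' (x - y), g' (x - y))) \<le> e * norm (x - y)"
    using r(1) s(1) by (intro exI[of _ "min r s"]) auto
qed

lemma strict_deriv_vec:
  fixes f :: "'a::euclidean_space \<Rightarrow> real^'m"
  assumes f: "\<And>j. strict_deriv (\<lambda>x. f x $ j) (L j) a"
  shows "strict_deriv f (\<lambda>h. \<chi> j. L j h) a"
  unfolding strict_deriv_def
proof (intro conjI allI impI)
  show "bounded_linear (\<lambda>h. \<chi> j. L j h)"
    using strict_deriv_bounded_linear[OF f] unfolding linear_conv_bounded_linear[symmetric]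
    by (auto intro!: linearI simp: vec_eq_iff linear_add linear_scale)
  fix e :: real assume "e > 0"
  then have e: "e / CARD('m) > 0" by simp
  have "\<forall>j. \<exists>r>0. \<forall>x\<in>ball a r. \<forall>y\<in>ball a r.
      norm (f x $ j - f y $ j - L j (x - y)) \<le> e / CARD('m) * norm (x - y)"
    using f e unfolding strict_deriv_def by blast
  then obtain r where r: "\<And>j. r j > 0" "\<And>j x y. x \<in> ball a (r j) \<Longrightarrow> y \<in> ball a (r j) \<Longrightarrow>
      norm (f x $ j - f y $ j - L j (x - y)) \<le> e / CARD('m) * norm (x - y)"
    by metis
  have m: "Min (range r) > 0" "\<And>j. Min (range r) \<le> r j" using r(1) by auto
  have "norm (f x - f y - (\<chi> j. L j (x - y))) \<le> e * norm (x - y)"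
    if "x \<in> ball a (Min (range r))" "y \<in> ball a (Min (range r))" for x y
  proof -
    let ?d = "f x - f y - (\<chi> j. L j (x - y))"
    have "norm ?d \<le> (\<Sum>j\<in>UNIV. \<bar>?d $ j\<bar>)" by (rule norm_le_l1_cart)
    also have "\<dots> \<le> (\<Sum>j\<in>(UNIV :: 'm set). e / CARD('m) * norm (x - y))"
    proof (rule sum_mono)
      fix j
      have "x \<in> ball a (r j)" "y \<in> ball a (r j)" using that m(2)[of j] by auto
      from r(2)[OF this] show "\<bar>?d $ j\<bar> \<le> e / CARD('m) * norm (x - y)"
        by simp
    qed
    finally show ?thesis by simp
  qed
  then show "\<exists>r>0. \<forall>x\<in>ball a r. \<forall>y\<in>ball a r.
      norm (f x - f y - (\<chi> j. L j (x - y))) \<le> e * norm (x - y)"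
    using m(1) by blast
qed

lemma real_analytic_at_strict_deriv:
  fixes h :: "real^'n \<Rightarrow> real^'m"
  assumes "real_analytic_at h a"
  obtains h' where "strict_deriv h h' a"
proof
  show "strict_deriv h (\<lambda>v. \<chi> j. dir_deriv v (\<lambda>x. h x $ j) a) a"
  proof (rule strict_deriv_vec, rule scalar_analytic_at_strict_deriv)
    show "scalar_analytic_at (\<lambda>x. h x $ j) a" for j
      using real_analytic_at_imp_scalar[OF assms, of "axis j 1"] by (simp add: inner_axis')
  qed
qed

section \<open>Charts\<close>

definition adapted_chart ::
    "(real^'n) set \<Rightarrow> (real^'n) set \<Rightarrow> (real^'n) set \<Rightarrow> (real^'n \<Rightarrow> real^'n) \<Rightarrow> (real^'n \<Rightarrow> real^'n)
      \<Rightarrow> (real^'n) set \<Rightarrow> bool" where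
  "adapted_chart Y U V \<phi> \<psi> S \<longleftrightarrow> analytic_diffeo U V \<phi> \<psi> \<and> subspace S \<and> \<phi> ` (U \<inter> Y) = V \<inter> S"

lemma adapted_chartD:
  assumes "adapted_chart Y U V \<phi> \<psi> S"
  shows "open U" "open V" "continuous_on U \<phi>" "continuous_on V \<psi>" "subspace S"
    "\<And>x. x \<in> U \<Longrightarrow> \<phi> x \<in> V" "\<And>v. v \<in> V \<Longrightarrow> \<psi> v \<in> U"
    "\<And>x. x \<in> U \<Longrightarrow> \<psi> (\<phi> x) = x" "\<And>v. v \<in> V \<Longrightarrow> \<phi> (\<psi> v) = v"
    "\<And>x. x \<in> U \<Longrightarrow> \<phi> x \<in> S \<longleftrightarrow> x \<in> Y" "\<And>v. v \<in> V \<Longrightarrow> \<psi> v \<in> Y \<longleftrightarrow> v \<in> S"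
    "real_analytic_on \<phi> U" "real_analytic_on \<psi> V"
proof -
  have h: "homeomorphism U V \<phi> \<psi>" and im: "\<phi> ` (U \<inter> Y) = V \<inter> S"
    using assms by (auto simp: adapted_chart_def analytic_diffeo_def)
  show "open U" "open V" "subspace S" "real_analytic_on \<phi> U" "real_analytic_on \<psi> V"
    using assms by (auto simp: adapted_chart_def analytic_diffeo_def)
  show "continuous_on U \<phi>" "continuous_on V \<psi>"
    using h by (auto simp: homeomorphism_def)
  show UV: "\<phi> x \<in> V" if "x \<in> U" for x using h that by (auto simp: homeomorphism_def)
  show VU: "\<psi> v \<in> U" if "v \<in> V" for v using h that by (auto simp: homeomorphism_def)
  show inv: "\<psi> (\<phi> x) = x" if "x \<in> U" for x using h that by (auto simp: homeomorphism_def)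
  show inv': "\<phi> (\<psi> v) = v" if "v \<in> V" for v using h that by (auto simp: homeomorphism_def)
  show S: "\<phi> x \<in> S \<longleftrightarrow> x \<in> Y" if "x \<in> U" for x
  proof
    assume "\<phi> x \<in> S"
    then have "\<phi> x \<in> \<phi> ` (U \<inter> Y)" using im UV[OF that] by blast
    then show "x \<in> Y" using inv that by (metis IntD1 IntD2 imageE)
  qed (use im that in blast)
  show "\<psi> v \<in> Y \<longleftrightarrow> v \<in> S" if "v \<in> V" for v
    using S[OF VU[OF that]] inv'[OF that] by simp
qed

text \<open>Differentiating \<phi> (\<psi> v) = v shows that the derivative of \<phi> at \<psi> v is
  a left inverse of D.\<close>

lemma adapted_chart_strict_deriv:
  assumes chart: "adapted_chart Y U V \<phi> \<psi> S" and v: "v \<in> V"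
  obtains D where "strict_deriv \<psi> D v" "\<And>h. D h = 0 \<Longrightarrow> h = 0"
proof -
  note c = adapted_chartD[OF chart]
  obtain D where D: "strict_deriv \<psi> D v"
    by (rule real_analytic_at_strict_deriv[of \<psi> v]) (use c(13) v in \<open>auto simp: real_analytic_on_def\<close>)
  obtain E where E: "strict_deriv \<phi> E (\<psi> v)"
    by (rule real_analytic_at_strict_deriv[of \<phi> "\<psi> v"])
       (use c(12) c(7)[OF v] in \<open>auto simp: real_analytic_on_def\<close>)
  have "((\<lambda>x. \<phi> (\<psi> x)) has_derivative (\<lambda>h. E (D h))) (at v)"
    by (rule has_derivative_compose[OF strict_deriv_imp_has_derivative[OF D]
          strict_deriv_imp_has_derivative[OF E]])
  then have "((\<lambda>x. x) has_derivative (\<lambda>h. E (D h))) (at v)"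
    by (rule has_derivative_transform_within_open[OF _ c(2) v c(9)])
  then have ED: "E (D h) = h" for h
    using has_derivative_unique[OF _ has_derivative_ident] by metis
  have "E 0 = 0"
    using strict_deriv_bounded_linear[OF E] linear_simps(3) by blast
  then have "h = 0" if "D h = 0" for h using ED[of h] that by simp
  with D that show ?thesis by blast
qed

lemma adapted_chart_nbhd:
  assumes chart: "adapted_chart Y U V \<phi> \<psi> S" and "x \<in> U" and "r > 0"
  obtains \<delta> where "\<delta> > 0" "ball x \<delta> \<subseteq> U" "\<And>y. y \<in> ball x \<delta> \<Longrightarrow> \<phi> y \<in> ball (\<phi> x) r"
proof -
  note c = adapted_chartD[OF chart]
  have "isCont \<phi> x" using c(1,3) \<open>x \<in> U\<close> by (simp add: continuous_on_eq_continuous_at)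
  then obtain d where d: "d > 0" "\<And>y. dist y x < d \<Longrightarrow> dist (\<phi> y) (\<phi> x) < r"
    using \<open>r > 0\<close> unfolding continuous_at_eps_delta by blast
  obtain e where e: "e > 0" "ball x e \<subseteq> U"
    using c(1) \<open>x \<in> U\<close> open_contains_ball by blast
  have *: "y \<in> U" "\<phi> y \<in> ball (\<phi> x) r" if "y \<in> ball x (min d e)" for y
  proof -
    have "y \<in> ball x e" using that by simp
    then show "y \<in> U" using e(2) by blast
    show "\<phi> y \<in> ball (\<phi> x) r" using d(2)[of y] that by (simp add: dist_commute)
  qed
  show ?thesis by (rule that[of "min d e"]) (use d(1) e(1) * in auto)
qed

text \<open>I is chosen so that the projection is injective on the tangent space, the image of S
  under D. Strict differentiability turns this into a lower bound for the projection of \<psi> v -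
  \<psi> w, and \<psi> is Lipschitz. The result concerns pairs of points, so it passes to smaller
  balls around nearby centres.\<close>

lemma adapted_chart_coordinates:
  assumes chart: "adapted_chart Y U V \<phi> \<psi> S" and x: "x \<in> U"
  obtains I C \<rho> where "card I = dim S" "C > 0" "\<rho> > 0" "ball x \<rho> \<subseteq> U"
    "\<And>y y'. y \<in> Y \<inter> ball x \<rho> \<Longrightarrow> y' \<in> Y \<inter> ball x \<rho> \<Longrightarrow> norm (y - y') \<le> C * norm (proj_on I (y - y'))"
proof -
  note c = adapted_chartD[OF chart]
  obtain D where D: "strict_deriv \<psi> D (\<phi> x)" "\<And>h. D h = 0 \<Longrightarrow> h = 0"
    using adapted_chart_strict_deriv[OF chart c(6)[OF x]] by blast
  have lin: "linear D" using strict_deriv_bounded_linear[OF D(1)] by (simp add: linear_conv_bounded_linear)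
  have sub: "subspace (D ` S)" by (rule linear_subspace_image[OF lin c(5)])
  obtain I where I: "card I = dim (D ` S)" "\<And>w. w \<in> D ` S \<Longrightarrow> proj_on I w = 0 \<Longrightarrow> w = 0"
    by (rule proj_on_injective_exists[OF sub]) blast
  have "inj_on D S"
    using linear_injective_on_subspace_0[OF lin c(5)] D(2) by blast
  then have dim: "dim (D ` S) = dim S"
    using c(5) by (metis dim_image_eq lin span_eq_iff)
  obtain k r where k: "k > 0" "r > 0" "\<And>v w. v \<in> ball (\<phi> x) r \<Longrightarrow> w \<in> ball (\<phi> x) r \<Longrightarrow> v - w \<in> S \<Longrightarrow>
      norm (v - w) \<le> k * norm (proj_on I (\<psi> v) - proj_on I (\<psi> w))"
    by (rule strict_deriv_bounded_below[OF strict_deriv_linear_compose[OF D(1) bounded_linear_proj_on] c(5)])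
       (use D(2) I(2) in blast)+
  obtain L s where L: "L > 0" "s > 0" "\<And>v w. v \<in> ball (\<phi> x) s \<Longrightarrow> w \<in> ball (\<phi> x) s \<Longrightarrow>
      norm (\<psi> v - \<psi> w) \<le> L * norm (v - w)"
    by (rule strict_deriv_lipschitz[OF D(1)]) blast
  obtain \<rho> where \<rho>: "\<rho> > 0" "ball x \<rho> \<subseteq> U" "\<And>y. y \<in> ball x \<rho> \<Longrightarrow> \<phi> y \<in> ball (\<phi> x) (min r s)"
    by (rule adapted_chart_nbhd[OF chart x, of "min r s"]) (use k(2) L(2) in auto)
  have "norm (y - y') \<le> L * k * norm (proj_on I (y - y'))"
    if y: "y \<in> Y \<inter> ball x \<rho>" "y' \<in> Y \<inter> ball x \<rho>" for y y'
  proof -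
    have U: "y \<in> U" "y' \<in> U" using y \<rho>(2) by auto
    have m: "\<phi> y \<in> ball (\<phi> x) r" "\<phi> y' \<in> ball (\<phi> x) r" "\<phi> y \<in> ball (\<phi> x) s" "\<phi> y' \<in> ball (\<phi> x) s"
      using \<rho>(3)[of y] \<rho>(3)[of y'] y by auto
    have "\<phi> y - \<phi> y' \<in> S" using c(5,10) U y by (auto intro: subspace_diff)
    from k(3)[OF m(1,2) this] have "norm (\<phi> y - \<phi> y') \<le> k * norm (proj_on I (y - y'))"
      using c(8) U by (simp add: linear_diff[OF linear_proj_on])
    then have "L * norm (\<phi> y - \<phi> y') \<le> L * (k * norm (proj_on I (y - y')))"
      using L(1) by (intro mult_left_mono) auto
    with L(3)[OF m(3,4)] show ?thesis using c(8) U by (simp add: mult.assoc)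
  qed
  then show ?thesis using that[of I "L * k" \<rho>] I(1) dim k(1) L(1) \<rho>(1,2) by simp
qed

section \<open>Invariance of dimension and of domain in charts\<close>

lemma adapted_chart_openin:
  assumes chart: "adapted_chart Y U V \<phi> \<psi> S" and "open N" "N \<subseteq> U"
  shows "openin (top_of_set S) (\<phi> ` (N \<inter> Y))"
proof -
  note c = adapted_chartD[OF chart]
  have "\<phi> ` (N \<inter> Y) = S \<inter> (V \<inter> \<psi> -` N)"
  proof (intro equalityI subsetI)
    fix v assume "v \<in> \<phi> ` (N \<inter> Y)"
    then show "v \<in> S \<inter> (V \<inter> \<psi> -` N)" using c(6,8,10) \<open>N \<subseteq> U\<close> by (auto simp: subset_iff)
  next
    fix v assume v: "v \<in> S \<inter> (V \<inter> \<psi> -` N)"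
    then have "v = \<phi> (\<psi> v)" "\<psi> v \<in> N \<inter> Y" using c(9,11) by auto
    then show "v \<in> \<phi> ` (N \<inter> Y)" by blast
  qed
  moreover have "open (V \<inter> \<psi> -` N)"
    using c(2,4) \<open>open N\<close> by (simp add: continuous_on_open_vimage Int_commute)
  ultimately show ?thesis by (simp add: openin_open_Int)
qed

text \<open>Invariance of dimension for the transition map. It determines the dimension of S in
  charts that do not prescribe it, such as those in \<open>analytic_submanifold_of\<close>.\<close>

lemma adapted_chart_dim_le:
  assumes chart: "adapted_chart Y U V \<phi> \<psi> S" and chart': "adapted_chart Y U' V' \<phi>' \<psi>' S'"
    and x: "x \<in> U \<inter> U' \<inter> Y"
  shows "dim S \<le> dim S'"
proof -
  note c = adapted_chartD[OF chart] and c' = adapted_chartD[OF chart']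
  let ?A = "\<phi> ` (U \<inter> U' \<inter> Y)"
  have psi: "\<psi> v \<in> U \<inter> U' \<inter> Y" if "v \<in> ?A" for v using that c(8) by auto
  have AV: "?A \<subseteq> V" using c(6) by auto
  show ?thesis
  proof (rule invariance_of_dimension_subspaces)
    show "openin (top_of_set S) ?A"
      by (rule adapted_chart_openin[OF chart]) (use c(1) c'(1) in auto)
    show "continuous_on ?A (\<phi>' \<circ> \<psi>)"
    proof (rule continuous_on_compose)
      show "continuous_on ?A \<psi>" using c(4) AV by (rule continuous_on_subset)
      show "continuous_on (\<psi> ` ?A) \<phi>'" using c'(3) by (rule continuous_on_subset) (use psi in blast)
    qed
    show "\<phi>' \<circ> \<psi> \<in> ?A \<rightarrow> S'" using psi c'(10) by auto
    show "inj_on (\<phi>' \<circ> \<psi>) ?A"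
    proof (rule comp_inj_on)
      show "inj_on \<psi> ?A" by (rule inj_on_inverseI[where g = \<phi>]) (use AV c(9) in blast)
      show "inj_on \<phi>' (\<psi> ` ?A)" by (rule inj_on_inverseI[where g = \<psi>']) (use psi c'(8) in blast)
    qed
    show "?A \<noteq> {}" using x by blast
  qed (use c(5) c'(5) in auto)
qed

text \<open>Read in the chart, the projection to the coordinates in I is injective between spaces of
  equal dimension, so its image is open by invariance of domain. The image then contains the
  projection of x with its i-th coordinate slightly changed to a rational value.\<close>

lemma adapted_chart_moves:
  fixes I :: "'n::finite set"
  assumes chart: "adapted_chart Y U V \<phi> \<psi> S" and card: "card I = dim S" and \<rho>: "ball x0 \<rho> \<subseteq> U"
    and lip: "\<And>y y'. y \<in> Y \<inter> ball x0 \<rho> \<Longrightarrow> y' \<in> Y \<inter> ball x0 \<rho> \<Longrightarrow>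
        norm (y - y') \<le> C * norm (proj_on I (y - y'))"
    and x: "x \<in> Y \<inter> ball x0 \<rho>" and i: "i \<in> I" and "\<epsilon> > 0"
  shows "\<exists>y\<in>Y. y \<noteq> x \<and> dist y x < \<epsilon> \<and> (\<forall>j\<in>I - {i}. y $ j = x $ j) \<and> y $ i \<in> \<rat>"
proof -
  note c = adapted_chartD[OF chart]
  define N where "N = ball x0 \<rho> \<inter> ball x \<epsilon>"
  have N: "open N" "N \<subseteq> U" using \<rho> by (auto simp: N_def)
  let ?A = "\<phi> ` (N \<inter> Y)"
  have psi: "\<psi> v \<in> N \<inter> Y" "\<phi> (\<psi> v) = v" if "v \<in> ?A" for v
    using that c(8) N(2) by (auto simp: subset_iff)
  have AV: "?A \<subseteq> V" using c(6) N(2) by auto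
  have "openin (top_of_set (coord_subspace I)) ((\<lambda>v. proj_on I (\<psi> v)) ` ?A)"
  proof (rule invariance_of_domain_subspaces)
    show "openin (top_of_set S) ?A" by (rule adapted_chart_openin[OF chart N])
    show "dim (coord_subspace I) \<le> dim S" by (simp add: dim_coord_subspace card)
    show "continuous_on ?A (\<lambda>v. proj_on I (\<psi> v))"
      using continuous_on_subset[OF c(4) AV]
      by (rule bounded_linear.continuous_on[OF bounded_linear_proj_on])
    show "inj_on (\<lambda>v. proj_on I (\<psi> v)) ?A"
    proof (rule inj_onI)
      fix v w assume vw: "v \<in> ?A" "w \<in> ?A" "proj_on I (\<psi> v) = proj_on I (\<psi> w)"
      have "norm (\<psi> v - \<psi> w) \<le> C * norm (proj_on I (\<psi> v - \<psi> w))"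
        using psi(1)[OF vw(1)] psi(1)[OF vw(2)] by (intro lip) (auto simp: N_def)
      then have "\<psi> v = \<psi> w" using vw(3) by (simp add: linear_diff[OF linear_proj_on])
      then have "\<phi> (\<psi> v) = \<phi> (\<psi> w)" by (rule arg_cong)
      then show "v = w" unfolding psi(2)[OF vw(1)] psi(2)[OF vw(2)] .
    qed
  qed (use c(5) subspace_coord_subspace in auto)
  also have "(\<lambda>v. proj_on I (\<psi> v)) ` ?A = proj_on I ` (N \<inter> Y)"
    unfolding image_image by (rule image_cong) (use c(8) N(2) in auto)
  finally have op: "openin (top_of_set (coord_subspace I)) (proj_on I ` (N \<inter> Y))" .
  have "x \<in> N \<inter> Y" using x \<open>\<epsilon> > 0\<close> by (simp add: N_def)
  then obtain \<delta> where \<delta>: "\<delta> > 0" "ball (proj_on I x) \<delta> \<inter> coord_subspace I \<subseteq> proj_on I ` (N \<inter> Y)"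
    using op unfolding openin_contains_ball by blast
  \<comment> \<open>Taking q strictly above x $ i makes the new point different from x.\<close>
  obtain q where q: "q \<in> \<rat>" "x $ i < q" "q < x $ i + \<delta>"
    using Rats_dense_in_real[of "x $ i" "x $ i + \<delta>"] \<delta>(1) by auto
  define p where "p = proj_on I x + (q - x $ i) *\<^sub>R axis i 1"
  have "p \<in> ball (proj_on I x) \<delta>"
    using q by (simp add: p_def dist_norm norm_axis_1)
  moreover have "p \<in> coord_subspace I"
    using i by (auto simp: p_def coord_subspace_def axis_def)
  ultimately obtain y where y: "y \<in> N \<inter> Y" "proj_on I y = p" using \<delta>(2) by blast
  have yj: "y $ j = (if j = i then q else x $ j)" if "j \<in> I" for j
    using arg_cong[OF y(2), of "\<lambda>z. z $ j"] that i by (auto simp: p_def axis_def)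
  show ?thesis
  proof (intro bexI[of _ y] conjI ballI)
    show "y \<noteq> x" using yj[OF i] q(2) by auto
    show "dist y x < \<epsilon>" using y(1) by (simp add: N_def dist_commute)
  qed (use y(1) yj i q(1) in auto)
qed

text \<open>Passage to the limit in one-sided difference quotients. It lets a Lipschitz bound
  between points of Y control tangent vectors.\<close>

lemma tangent_bounded_by_projection:
  assumes D: "strict_deriv \<psi> D v"
    and lip: "\<forall>\<^sub>F t in at_right 0. norm (\<psi> (v + t *\<^sub>R s) - \<psi> v) \<le> C * norm (proj_on I (\<psi> (v + t *\<^sub>R s) - \<psi> v))"
  shows "norm (D s) \<le> C * norm (proj_on I (D s))"
proof -
  interpret D: bounded_linear D using D by (rule strict_deriv_bounded_linear)
  have "((\<lambda>t::real. v + t *\<^sub>R s) has_derivative (\<lambda>t. t *\<^sub>R s)) (at 0)"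
    by (auto intro!: derivative_eq_intros)
  from has_derivative_compose[OF this, of \<psi> D] strict_deriv_imp_has_derivative[OF D]
  have "((\<lambda>t. \<psi> (v + t *\<^sub>R s)) has_derivative (\<lambda>t. t *\<^sub>R D s)) (at 0)"
    by (simp add: D.scaleR)
  then have d0: "((\<lambda>t. norm (\<psi> (v + t *\<^sub>R s) - \<psi> v - t *\<^sub>R D s) / norm t) \<longlongrightarrow> 0) (at 0)"
    unfolding has_derivative_at by simp
  have quot: "norm (\<psi> (v + t *\<^sub>R s) - \<psi> v - t *\<^sub>R D s) / norm t
      = norm ((\<psi> (v + t *\<^sub>R s) - \<psi> v) /\<^sub>R t - D s)" if "t \<noteq> 0" for t :: real
  proof -
    have "(\<psi> (v + t *\<^sub>R s) - \<psi> v) /\<^sub>R t - D s = (\<psi> (v + t *\<^sub>R s) - \<psi> v - t *\<^sub>R D s) /\<^sub>R t"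
      using that by (simp add: scaleR_diff_right)
    then show ?thesis by (simp add: divide_inverse mult.commute)
  qed
  have "((\<lambda>t. norm ((\<psi> (v + t *\<^sub>R s) - \<psi> v) /\<^sub>R t - D s)) \<longlongrightarrow> 0) (at 0)"
  proof (rule Lim_transform_eventually[OF d0])
    show "\<forall>\<^sub>F t in at 0. norm (\<psi> (v + t *\<^sub>R s) - \<psi> v - t *\<^sub>R D s) / norm t
        = norm ((\<psi> (v + t *\<^sub>R s) - \<psi> v) /\<^sub>R t - D s)"
      unfolding eventually_at by (intro exI[of _ 1] conjI ballI impI quot) auto
  qed
  then have "((\<lambda>t. (\<psi> (v + t *\<^sub>R s) - \<psi> v) /\<^sub>R t - D s) \<longlongrightarrow> 0) (at 0)"
    by (rule tendsto_norm_zero_cancel)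
  then have "((\<lambda>t. (\<psi> (v + t *\<^sub>R s) - \<psi> v) /\<^sub>R t) \<longlongrightarrow> D s) (at 0)"
    by (rule LIM_zero_cancel)
  then have lim: "((\<lambda>t. (\<psi> (v + t *\<^sub>R s) - \<psi> v) /\<^sub>R t) \<longlongrightarrow> D s) (at_right 0)"
    by (rule tendsto_within_subset) simp
  show ?thesis
  proof (rule tendsto_le[OF trivial_limit_at_right_real])
    show "((\<lambda>t. norm ((\<psi> (v + t *\<^sub>R s) - \<psi> v) /\<^sub>R t)) \<longlongrightarrow> norm (D s)) (at_right 0)"
      by (intro tendsto_norm lim)
    show "((\<lambda>t. C * norm (proj_on I ((\<psi> (v + t *\<^sub>R s) - \<psi> v) /\<^sub>R t))) \<longlongrightarrow> C * norm (proj_on I (D s))) (at_right 0)"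
      by (intro tendsto_mult tendsto_const tendsto_norm bounded_linear.tendsto[OF bounded_linear_proj_on] lim)
    show "\<forall>\<^sub>F t in at_right 0. norm ((\<psi> (v + t *\<^sub>R s) - \<psi> v) /\<^sub>R t)
        \<le> C * norm (proj_on I ((\<psi> (v + t *\<^sub>R s) - \<psi> v) /\<^sub>R t))"
      using lip eventually_at_right_less[of 0]
    proof eventually_elim
      case (elim t)
      then show ?case
        by (simp add: linear_scale[OF linear_proj_on] divide_simps)
    qed
  qed
qed

lemma thin_at_regular_zero_set:
  assumes chart: "adapted_chart Y U V \<phi> \<psi> S" and z: "z \<in> U \<inter> Y"
    and F: "strict_deriv F F' (\<phi> z)" and s: "s \<in> S" "F' s \<noteq> (0::real)"
    and K: "\<And>y. y \<in> K \<Longrightarrow> y \<in> U \<Longrightarrow> y \<in> Y \<and> F (\<phi> y) = 0"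
    and "\<rho> > 0" and lip: "\<And>y y'. y \<in> Y \<inter> ball z \<rho> \<Longrightarrow> y' \<in> Y \<inter> ball z \<rho> \<Longrightarrow>
        norm (y - y') \<le> C * norm (proj_on I (y - y'))"
  shows "thin_at I K z"
proof -
  note c = adapted_chartD[OF chart]
  let ?v = "\<phi> z"
  have v: "?v \<in> V" "?v \<in> S" using c(6,10) z by auto
  obtain D where D: "strict_deriv \<psi> D ?v" "\<And>h. D h = 0 \<Longrightarrow> h = 0"
    using adapted_chart_strict_deriv[OF chart v(1)] by blast
  interpret D: bounded_linear D using D(1) by (rule strict_deriv_bounded_linear)
  interpret F': bounded_linear F' using F by (rule strict_deriv_bounded_linear)
  \<comment> \<open>The Lipschitz bound is applied to the curves \<psi> (\<phi> z + t h), which run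
    in Y because h lies in S.\<close>
  have tangent: "D h = 0" if h: "h \<in> S" "proj_on I (D h) = 0" for h
  proof -
    have "open (V \<inter> \<psi> -` ball z \<rho>)"
      using c(2,4) by (simp add: continuous_on_open_vimage Int_commute)
    moreover have "((\<lambda>t. ?v + t *\<^sub>R h) \<longlongrightarrow> ?v) (at_right 0)"
      by (auto intro!: tendsto_eq_intros)
    moreover have "?v \<in> V \<inter> \<psi> -` ball z \<rho>"
      using v(1) c(8) z \<open>\<rho> > 0\<close> by simp
    ultimately have "\<forall>\<^sub>F t in at_right 0. ?v + t *\<^sub>R h \<in> V \<inter> \<psi> -` ball z \<rho>"
      by (metis topological_tendstoD)
    then have "\<forall>\<^sub>F t in at_right 0. norm (\<psi> (?v + t *\<^sub>R h) - \<psi> ?v)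
        \<le> C * norm (proj_on I (\<psi> (?v + t *\<^sub>R h) - \<psi> ?v))"
    proof eventually_elim
      case (elim t)
      have "?v + t *\<^sub>R h \<in> S" using c(5) v(2) h(1) by (intro subspace_add subspace_scale)
      then have "\<psi> (?v + t *\<^sub>R h) \<in> Y \<inter> ball z \<rho>" using c(11) elim by auto
      moreover have "\<psi> ?v \<in> Y \<inter> ball z \<rho>" using c(8) z \<open>\<rho> > 0\<close> by simp
      ultimately show ?case by (rule lip)
    qed
    from tangent_bounded_by_projection[OF D(1) this] show ?thesis using h(2) by simp
  qed
  define T where "T = {h \<in> S. F' h = 0}"
  have T: "subspace T"
    using c(5) by (auto simp: T_def subspace_def F'.add F'.scaleR F'.zero)
  have injS: "inj_on D S"
    using linear_injective_on_subspace_0[OF D.linear c(5)] D(2) by blast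
  \<comment> \<open>The size of I is not tied to S by assumption; the inequality comes from
    injectivity of the projection on the tangent space.\<close>
  have "dim (D ` S) \<le> card I"
    by (rule proj_on_injective_dim_le) (use linear_subspace_image[OF D.linear c(5)] tangent in auto)
  also have "dim (D ` S) = dim S"
    using c(5) injS by (metis dim_image_eq D.linear span_eq_iff)
  finally have dimS: "dim S \<le> card I" .
  have "T \<subset> S" using s by (auto simp: T_def)
  then have "dim T < dim S"
    using T c(5) by (metis dim_psubset span_eq_iff)
  then have dimT: "dim (D ` T) < card I"
    using dim_image_le[OF D.linear, of T] dimS by linarith
  have injT: "w = 0" if "w \<in> D ` T" "proj_on I w = 0" for w
    using that tangent by (auto simp: T_def)
  have "\<exists>i\<in>I. \<forall>w\<in>D ` T. proj_on (I - {i}) w = 0 \<longrightarrow> w = 0"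
  proof (rule proj_on_drop_coordinate[OF linear_subspace_image[OF D.linear T] _ dimT])
    show "w = 0" if "w \<in> D ` T" "proj_on I w = 0" for w
      using that by (rule injT)
  qed blast
  then obtain i where i: "i \<in> I" "\<forall>w\<in>D ` T. proj_on (I - {i}) w = 0 \<longrightarrow> w = 0"
    by (rule bexE)
  have G: "strict_deriv (\<lambda>v. (F v, proj_on (I - {i}) (\<psi> v))) (\<lambda>h. (F' h, proj_on (I - {i}) (D h))) ?v"
    by (rule strict_deriv_Pair[OF F strict_deriv_linear_compose[OF D(1) bounded_linear_proj_on]])
  have injG: "h = 0" if "h \<in> S" "(F' h, proj_on (I - {i}) (D h)) = 0" for h
  proof -
    have "D h \<in> D ` T" "proj_on (I - {i}) (D h) = 0"
      using that by (auto simp: T_def zero_prod_def)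
    with i(2) have "D h = 0" by (elim ballE) auto
    then show ?thesis by (rule D(2))
  qed
  obtain k r where k: "r > 0" "\<And>v w. v \<in> ball ?v r \<Longrightarrow> w \<in> ball ?v r \<Longrightarrow> v - w \<in> S \<Longrightarrow>
      norm (v - w) \<le> k * norm ((F v, proj_on (I - {i}) (\<psi> v)) - (F w, proj_on (I - {i}) (\<psi> w)))"
    by (rule strict_deriv_bounded_below[OF G c(5) injG]) blast+
  obtain \<delta> where \<delta>: "\<delta> > 0" "ball z \<delta> \<subseteq> U" "\<And>y. y \<in> ball z \<delta> \<Longrightarrow> \<phi> y \<in> ball ?v r"
    by (rule adapted_chart_nbhd[OF chart _ k(1), of z]) (use z in auto)
  show ?thesis
    unfolding thin_at_def
  proof (intro bexI[of _ i] exI[of _ \<delta>] conjI ballI impI)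
    fix x y assume x: "x \<in> K \<inter> ball z \<delta>" and y: "y \<in> K \<inter> ball z \<delta>"
      and eq: "\<forall>j\<in>I - {i}. x $ j = y $ j"
    have U: "x \<in> U" "y \<in> U" using x y \<delta>(2) by auto
    have KF: "x \<in> Y" "y \<in> Y" "F (\<phi> x) = 0" "F (\<phi> y) = 0" using K U x y by auto
    have "\<phi> x - \<phi> y \<in> S" using KF c(5,10) U by (auto intro: subspace_diff)
    moreover have "proj_on (I - {i}) x = proj_on (I - {i}) y"
      using eq by (auto simp: vec_eq_iff)
    ultimately have "\<phi> x = \<phi> y"
      using k(2)[of "\<phi> x" "\<phi> y"] \<delta>(3) x y KF c(8) U by (simp add: zero_prod_def[symmetric])
    then show "x = y" using c(8) U by metis
  qed (use i(1) \<delta>(1) in auto)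
qed

section \<open>Submanifolds and hyperplane sections are thin\<close>

lemma analytic_submanifold_chart:
  assumes "analytic_submanifold d Y" "x \<in> Y"
  obtains U V \<phi> \<psi> S where "x \<in> U" "adapted_chart Y U V \<phi> \<psi> S" "dim S = d"
  using assms unfolding analytic_submanifold_def adapted_chart_def by meson

lemma adapted_chart_dim:
  assumes "analytic_submanifold d Y" "adapted_chart Y U V \<phi> \<psi> S" "x \<in> U \<inter> Y"
  shows "dim S = d"
proof -
  obtain U' V' \<phi>' \<psi>' S' where c: "x \<in> U'" "adapted_chart Y U' V' \<phi>' \<psi>' S'" "dim S' = d"
    by (rule analytic_submanifold_chart[OF assms(1), of x]) (use assms(3) in auto)
  have "dim S \<le> dim S'" by (rule adapted_chart_dim_le[OF assms(2) c(2), of x]) (use assms(3) c(1) in auto)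
  moreover have "dim S' \<le> dim S"
    by (rule adapted_chart_dim_le[OF c(2) assms(2), of x]) (use assms(3) c(1) in auto)
  ultimately show ?thesis using c(3) by simp
qed

lemma analytic_submanifold_of_chart:
  assumes "analytic_submanifold_of e R Y" "x \<in> R"
  obtains U V \<phi> \<psi> S T where "x \<in> U" "adapted_chart Y U V \<phi> \<psi> S" "subspace T" "T \<subseteq> S" "dim T = e"
    "\<And>y. y \<in> U \<Longrightarrow> \<phi> y \<in> T \<longleftrightarrow> y \<in> R"
proof -
  obtain U V \<phi> \<psi> S T where *: "x \<in> U" "adapted_chart Y U V \<phi> \<psi> S" "subspace T" "T \<subseteq> S" "dim T = e"
    and im: "\<phi> ` (U \<inter> R) = V \<inter> T"
    using assms unfolding analytic_submanifold_of_def adapted_chart_def by meson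
  note c = adapted_chartD[OF *(2)]
  have "\<phi> y \<in> T \<longleftrightarrow> y \<in> R" if y: "y \<in> U" for y
  proof
    assume "\<phi> y \<in> T"
    then have "\<phi> y \<in> \<phi> ` (U \<inter> R)" using im c(6)[OF y] by blast
    then show "y \<in> R" using c(8) y by (metis IntD1 IntD2 imageE)
  qed (use im y in blast)
  with * that show ?thesis by blast
qed

text \<open>If e >= d, the slice T fills S in every chart and R is open in Y; being also closed,
  nonempty and different from Y, it would disconnect Y.\<close>

lemma proper_closed_submanifold_dim_less:
  assumes Y: "analytic_submanifold d Y" "connected Y" and R: "analytic_submanifold_of e R Y"
    "closedin (top_of_set Y) R" "R \<noteq> Y" "R \<noteq> {}"
  shows "e < d"
proof (rule ccontr)
  assume "\<not> e < d"
  have RY: "R \<subseteq> Y" using R(1) by (simp add: analytic_submanifold_of_def)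
  have "openin (top_of_set Y) R"
  proof (subst openin_subopen, intro ballI)
    fix x assume x: "x \<in> R"
    obtain U V \<phi> \<psi> S T where c: "x \<in> U" "adapted_chart Y U V \<phi> \<psi> S" "subspace T" "T \<subseteq> S" "dim T = e"
      "\<And>y. y \<in> U \<Longrightarrow> \<phi> y \<in> T \<longleftrightarrow> y \<in> R"
      by (rule analytic_submanifold_of_chart[OF R(1) x]) blast
    have "dim S = d" by (rule adapted_chart_dim[OF Y(1) c(2), of x]) (use c(1) x RY in auto)
    then have "T = S"
      using \<open>\<not> e < d\<close> c(5) by (intro subspace_dim_equal c adapted_chartD(5)[OF c(2)]) auto
    then have "Y \<inter> U \<subseteq> R" using adapted_chartD(10)[OF c(2)] c(6) by blast
    moreover have "openin (top_of_set Y) (Y \<inter> U)"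
      using adapted_chartD(1)[OF c(2)] by (rule openin_open_Int)
    ultimately show "\<exists>T. openin (top_of_set Y) T \<and> x \<in> T \<and> T \<subseteq> R"
      using x RY c(1) by blast
  qed
  then show False using Y(2) R(2-4) unfolding connected_clopen by blast
qed

text \<open>In a chart R is a proper linear slice T of S, so a linear functional that vanishes on T
  but not on S is a regular equation for a set containing R.\<close>

lemma proper_closed_submanifold_thin:
  assumes Y: "analytic_submanifold d Y" "connected Y"
    and R: "proper_closed_analytic_submanifold_of R Y" and z: "z \<in> R"
    and \<rho>: "\<rho> > 0" and lip: "\<And>y y'. y \<in> Y \<inter> ball z \<rho> \<Longrightarrow> y' \<in> Y \<inter> ball z \<rho> \<Longrightarrow>
        norm (y - y') \<le> C * norm (proj_on I (y - y'))"
  shows "thin_at I R z"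
proof -
  obtain e where e: "analytic_submanifold_of e R Y" "closedin (top_of_set Y) R" "R \<noteq> Y"
    using R by (auto simp: proper_closed_analytic_submanifold_of_def)
  have RY: "R \<subseteq> Y" using e(1) by (simp add: analytic_submanifold_of_def)
  have "e < d" by (rule proper_closed_submanifold_dim_less[OF Y e]) (use z in auto)
  obtain U V \<phi> \<psi> S T where c: "z \<in> U" "adapted_chart Y U V \<phi> \<psi> S" "subspace T" "T \<subseteq> S" "dim T = e"
    "\<And>y. y \<in> U \<Longrightarrow> \<phi> y \<in> T \<longleftrightarrow> y \<in> R"
    by (rule analytic_submanifold_of_chart[OF e(1) z]) blast
  have "dim S = d" by (rule adapted_chart_dim[OF Y(1) c(2), of z]) (use c(1) z RY in auto)
  then have "T \<noteq> S" using \<open>e < d\<close> c(5) by auto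
  then obtain s where s: "s \<in> S" "s \<notin> T" using c(4) by blast
  \<comment> \<open>The component a of s orthogonal to T gives the functional: a \<bullet> s = a
    \<bullet> a is nonzero because s is not in T.\<close>
  obtain p a where pa: "p \<in> span T" "\<And>w. w \<in> span T \<Longrightarrow> orthogonal a w" "s = p + a"
    by (rule orthogonal_subspace_decomp_exists[of T s]) blast
  have sp: "span T = T" using c(3) by (simp add: span_eq_iff)
  have "a \<noteq> 0" using pa(1,3) s(2) sp by auto
  have "a \<bullet> s = a \<bullet> a" using pa by (simp add: inner_add_right orthogonal_def)
  with \<open>a \<noteq> 0\<close> have as: "a \<bullet> s \<noteq> 0" by simp
  have sd: "strict_deriv (\<lambda>v. a \<bullet> v) (\<lambda>v. a \<bullet> v) (\<phi> z)"
    unfolding strict_deriv_def by (auto simp: inner_diff_right bounded_linear_inner_right intro: exI[of _ 1])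
  show ?thesis
  proof (rule thin_at_regular_zero_set[OF c(2) _ sd s(1) _ _ \<rho> lip])
    show "a \<bullet> s \<noteq> 0" by (rule as)
    show "z \<in> U \<inter> Y" using c(1) z RY by auto
    show "y \<in> Y \<and> a \<bullet> \<phi> y = 0" if "y \<in> R" "y \<in> U" for y
      using that c(6) RY pa(2) sp by (auto simp: orthogonal_def)
  qed
qed

section \<open>Affine functionals on a connected analytic submanifold\<close>

lemma chart_functional_analytic:
  assumes "adapted_chart Y U V \<phi> \<psi> S" "v \<in> V"
  shows "scalar_analytic_at (\<lambda>v. a \<bullet> \<psi> v + b) v"
proof (rule scalar_analytic_at_add)
  have "real_analytic_at \<psi> v"
    using adapted_chartD(13)[OF assms(1)] assms(2) by (auto simp: real_analytic_on_def)
  then show "scalar_analytic_at (\<lambda>v. a \<bullet> \<psi> v) v" by (rule real_analytic_at_imp_scalar)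
qed simp

text \<open>Identity theorem by connectedness: the points near which Y lies in the hyperplane form a
  set that is open and closed in Y. For closedness, the points of Y near a limit point are joined to
  a point of the set by segments in a chart.\<close>

lemma hyperplane_identity:
  assumes Y: "analytic_submanifold d Y" "connected Y"
    and x: "x \<in> Y" and N: "open N" "x \<in> N" "\<And>y. y \<in> N \<inter> Y \<Longrightarrow> a \<bullet> y = b"
    and "y \<in> Y"
  shows "a \<bullet> y = b"
proof -
  define E where "E = {x \<in> Y. \<exists>N. open N \<and> x \<in> N \<and> (\<forall>y\<in>N \<inter> Y. a \<bullet> y = b)}"
  have "openin (top_of_set Y) E"
  proof (subst openin_subopen, intro ballI)
    fix x assume "x \<in> E"
    then obtain N where N: "x \<in> Y" "open N" "x \<in> N" "\<forall>y\<in>N \<inter> Y. a \<bullet> y = b" by (auto simp: E_def)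
    then have "Y \<inter> N \<subseteq> E" by (auto simp: E_def)
    then show "\<exists>T. openin (top_of_set Y) T \<and> x \<in> T \<and> T \<subseteq> E"
      using N openin_open_Int[of N Y] by blast
  qed
  moreover have "closedin (top_of_set Y) E"
    unfolding closedin_limpt
  proof (intro conjI allI impI)
    fix z assume "z islimpt E \<and> z \<in> Y"
    then have z: "z islimpt E" "z \<in> Y" by auto
    obtain U V \<phi> \<psi> S where zU: "z \<in> U" and chart: "adapted_chart Y U V \<phi> \<psi> S"
      by (rule analytic_submanifold_chart[OF Y(1) z(2)]) blast
    note c = adapted_chartD[OF chart]
    obtain r where r: "r > 0" "ball (\<phi> z) r \<subseteq> V"
      using c(2) c(6)[OF zU] open_contains_ball by blast
    obtain \<delta> where \<delta>: "\<delta> > 0" "ball z \<delta> \<subseteq> U" "\<And>y. y \<in> ball z \<delta> \<Longrightarrow> \<phi> y \<in> ball (\<phi> z) r"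
      by (rule adapted_chart_nbhd[OF chart zU r(1)]) blast
    obtain y' where "y' \<in> E" "dist y' z < \<delta>"
      using z(1) \<delta>(1) by (auto simp: islimpt_approachable)
    then obtain N' where y': "y' \<in> ball z \<delta>" "y' \<in> Y" "open N'" "y' \<in> N'" "\<forall>y\<in>N' \<inter> Y. a \<bullet> y = b"
      by (auto simp: E_def dist_commute)
    have y'U: "y' \<in> U" using y'(1) \<delta>(2) by blast
    let ?w = "\<lambda>v. a \<bullet> \<psi> v + (- b)"
    have "a \<bullet> y = b" if y: "y \<in> ball z \<delta> \<inter> Y" for y
    proof -
      have yU: "y \<in> U" using y \<delta>(2) by blast
      define h where "h = \<phi> y - \<phi> y'"
      have h: "h \<in> S" using c(5,10) y y' yU y'U by (auto simp: h_def intro: subspace_diff)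
      \<comment> \<open>The segment from \<phi> y' to \<phi> y stays in a ball inside V, and its
        direction lies in S. Near its start \<psi> maps it into N' and Y, where the functional
        equals b.\<close>
      have "?w (\<phi> y' + h) = 0"
      proof (rule analytic_zero_on_segment)
        fix t :: real assume t: "t \<in> {0..1}"
        have "(1 - t) *\<^sub>R \<phi> y' + t *\<^sub>R \<phi> y \<in> ball (\<phi> z) r"
          using t \<delta>(3) y y'(1) by (intro convexD[OF convex_ball]) auto
        then have "\<phi> y' + t *\<^sub>R h \<in> V" using r(2) by (auto simp: h_def algebra_simps)
        then show "scalar_analytic_at ?w (\<phi> y' + t *\<^sub>R h)" by (rule chart_functional_analytic[OF chart])
      next
        have "open (V \<inter> \<psi> -` N')"
          using c(2,4) y'(3) by (simp add: continuous_on_open_vimage Int_commute)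
        moreover have "((\<lambda>t. \<phi> y' + t *\<^sub>R h) \<longlongrightarrow> \<phi> y') (nhds 0)"
          by (auto intro!: tendsto_eq_intros filterlim_ident)
        moreover have "\<phi> y' \<in> V \<inter> \<psi> -` N'" using c(6,8) y'U y'(4) by auto
        ultimately have "\<forall>\<^sub>F t in nhds 0. \<phi> y' + t *\<^sub>R h \<in> V \<inter> \<psi> -` N'"
          by (metis topological_tendstoD)
        then show "\<forall>\<^sub>F t in nhds 0. ?w (\<phi> y' + t *\<^sub>R h) = 0"
        proof eventually_elim
          case (elim t)
          have "\<phi> y' + t *\<^sub>R h \<in> S"
            using c(5,10) y'(2) y'U h by (intro subspace_add subspace_scale) auto
          then have "\<psi> (\<phi> y' + t *\<^sub>R h) \<in> N' \<inter> Y" using c(11) elim by auto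
          then show ?case using y'(5) by simp
        qed
      qed
      then show ?thesis using c(8)[OF yU] by (simp add: h_def)
    qed
    then show "z \<in> E" using z(2) \<delta>(1) by (auto simp: E_def intro!: exI[of _ "ball z \<delta>"])
  qed (auto simp: E_def)
  moreover have "x \<in> E" using x N by (auto simp: E_def)
  ultimately have "E = Y" using Y(2) unfolding connected_clopen by blast
  then obtain N where "y \<in> N" "\<forall>y\<in>N \<inter> Y. a \<bullet> y = b" using \<open>y \<in> Y\<close> by (auto simp: E_def)
  then show ?thesis using \<open>y \<in> Y\<close> by blast
qed

text \<open>The head of the list is the derivative taken last. Removing heads leads to the empty
  list, where w p = 0, so somewhere a zero derivative is followed by a nonzero one.\<close>

lemma iter_deriv_first_nonzero:
  assumes "w p = 0" "iter_deriv bs w p \<noteq> 0" "bs \<in> lists B"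
  shows "\<exists>b\<in>B. \<exists>cs\<in>lists B. iter_deriv cs w p = 0 \<and> dir_deriv b (iter_deriv cs w) p \<noteq> 0"
  using assms(2,3)
proof (induction bs)
  case (Cons b bs)
  show ?case
  proof (cases "iter_deriv bs w p = 0")
    case True
    with Cons.prems show ?thesis by (auto intro!: bexI[of _ b] bexI[of _ bs])
  qed (use Cons in auto)
qed (use assms(1) in simp)

text \<open>The family must be fixed before z is known, so it consists of the zero sets of all
  iterated derivatives along a finite basis of S, indexed by countably many lists. Each z in the
  section is a regular zero of one of these derivatives.\<close>

lemma hyperplane_section_covered_by_thin_sets:
  assumes Y: "analytic_submanifold d Y" "connected Y"
    and chart: "adapted_chart Y U V \<phi> \<psi> S" and "\<not> (\<forall>y\<in>Y. a \<bullet> y = b)"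
  shows "\<exists>\<K>. countable \<K> \<and>
    (\<forall>K\<in>\<K>. \<forall>x\<in>Y \<inter> U. x \<notin> K \<longrightarrow> (\<exists>\<epsilon>>0. ball x \<epsilon> \<inter> Y \<inter> K = {})) \<and>
    (\<forall>z\<in>Y \<inter> U. a \<bullet> z = b \<longrightarrow> (\<exists>K\<in>\<K>. z \<in> K \<and> (\<forall>I C \<rho>. \<rho> > 0 \<longrightarrow>
       (\<forall>y\<in>Y \<inter> ball z \<rho>. \<forall>y'\<in>Y \<inter> ball z \<rho>. norm (y - y') \<le> C * norm (proj_on I (y - y'))) \<longrightarrow>
       thin_at I K z)))"
proof -
  note c = adapted_chartD[OF chart]
  define w where "w = (\<lambda>v. a \<bullet> \<psi> v + (- b))"
  have an: "scalar_analytic_at w v" if "v \<in> V" for v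
    unfolding w_def using chart that by (rule chart_functional_analytic)
  have wphi: "w (\<phi> y) = 0 \<longleftrightarrow> a \<bullet> y = b" if "y \<in> U" for y
    using c(8)[OF that] by (auto simp: w_def)
  obtain B where B: "B \<subseteq> S" "independent B" "S \<subseteq> span B" "card B = dim S"
    by (rule basis_exists[of S]) blast
  have finB: "finite B" using B(2) by (rule independent_imp_finite)
  have spB: "span B = S" using B c(5) by (metis span_minimal subset_antisym)
  define K where "K bs = {y \<in> Y \<inter> U. iter_deriv bs w (\<phi> y) = 0}" for bs
  have ani: "scalar_analytic_at (iter_deriv bs w) v" if "v \<in> V" for bs v
    using an[OF that] by (rule scalar_analytic_at_iter_deriv)
  show ?thesis
  proof (intro exI[of _ "K ` lists B"] conjI ballI impI)
    show "countable (K ` lists B)"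
      using finB by (intro countable_image countable_lists countable_finite)
  next
    fix L x assume L: "L \<in> K ` lists B" and x: "x \<in> Y \<inter> U" "x \<notin> L"
    obtain bs where bs: "L = K bs" using L by blast
    have "isCont \<phi> x" using c(1,3) x by (simp add: continuous_on_eq_continuous_at)
    moreover have "isCont (iter_deriv bs w) (\<phi> x)"
      using strict_deriv_imp_has_derivative[OF scalar_analytic_at_strict_deriv[OF ani]] c(6) x
      by (blast intro: has_derivative_continuous)
    ultimately have "isCont (\<lambda>y. iter_deriv bs w (\<phi> y)) x"
      by (rule isCont_o2)
    moreover have "iter_deriv bs w (\<phi> x) \<noteq> 0" using x by (auto simp: bs K_def)
    ultimately obtain \<epsilon> where "\<epsilon> > 0" "\<forall>y. dist x y < \<epsilon> \<longrightarrow> iter_deriv bs w (\<phi> y) \<noteq> 0"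
      using continuous_at_avoid by blast
    then show "\<exists>\<epsilon>>0. ball x \<epsilon> \<inter> Y \<inter> L = {}"
      by (intro exI[of _ \<epsilon>]) (auto simp: bs K_def)
  next
    fix z assume z: "z \<in> Y \<inter> U" "a \<bullet> z = b"
    \<comment> \<open>Otherwise w vanishes on the slice near \<phi> z, and the identity theorem puts
      all of Y into the hyperplane.\<close>
    have "\<exists>bs\<in>lists B. iter_deriv bs w (\<phi> z) \<noteq> 0"
    proof (rule ccontr)
      assume "\<not> (\<exists>bs\<in>lists B. iter_deriv bs w (\<phi> z) \<noteq> 0)"
      then have "\<exists>r>0. \<forall>v\<in>ball (\<phi> z) r. v - \<phi> z \<in> span B \<longrightarrow> w v = 0"
        using c(6) z by (intro zero_near_if_iter_derivs_zero[OF c(2) _ an finB]) auto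
      then obtain r where r: "r > 0" "\<And>v. v \<in> ball (\<phi> z) r \<Longrightarrow> v - \<phi> z \<in> S \<Longrightarrow> w v = 0"
        unfolding spB by blast
      obtain \<delta> where \<delta>: "\<delta> > 0" "ball z \<delta> \<subseteq> U" "\<And>y. y \<in> ball z \<delta> \<Longrightarrow> \<phi> y \<in> ball (\<phi> z) r"
        by (rule adapted_chart_nbhd[OF chart _ r(1), of z]) (use z in auto)
      have "a \<bullet> y = b" if y: "y \<in> ball z \<delta> \<inter> Y" for y
      proof -
        have yU: "y \<in> U" using y \<delta>(2) by blast
        have "\<phi> y - \<phi> z \<in> S" using c(5,10) yU y z by (auto intro: subspace_diff)
        then show ?thesis using r(2)[of "\<phi> y"] \<delta>(3)[of y] y wphi[OF yU] by auto
      qed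
      then have "\<forall>y\<in>Y. a \<bullet> y = b"
        using hyperplane_identity[OF Y, of z "ball z \<delta>" a b] z \<delta>(1) by auto
      with assms(4) show False by blast
    qed
    then obtain h cs where h: "h \<in> B" "cs \<in> lists B" "iter_deriv cs w (\<phi> z) = 0"
        "dir_deriv h (iter_deriv cs w) (\<phi> z) \<noteq> 0"
      using iter_deriv_first_nonzero[of w "\<phi> z" _ B] wphi z by blast
    have thin: "thin_at I (K cs) z"
      if \<rho>: "\<rho> > 0" and lip: "\<forall>y\<in>Y \<inter> ball z \<rho>. \<forall>y'\<in>Y \<inter> ball z \<rho>. norm (y - y') \<le> C * norm (proj_on I (y - y'))"
      for I C \<rho>
    proof (rule thin_at_regular_zero_set[OF chart _ scalar_analytic_at_strict_deriv[OF ani] _ _ _ \<rho>])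
      show "dir_deriv h (iter_deriv cs w) (\<phi> z) \<noteq> 0" by (rule h(4))
      show "h \<in> S" using h(1) B(1) by blast
      show "norm (y - y') \<le> C * norm (proj_on I (y - y'))"
        if "y \<in> Y \<inter> ball z \<rho>" "y' \<in> Y \<inter> ball z \<rho>" for y y'
        using lip that by blast
    qed (use z c(6) in \<open>auto simp: K_def\<close>)
    show "\<exists>L\<in>K ` lists B. z \<in> L \<and> (\<forall>I C \<rho>. \<rho> > 0 \<longrightarrow>
       (\<forall>y\<in>Y \<inter> ball z \<rho>. \<forall>y'\<in>Y \<inter> ball z \<rho>. norm (y - y') \<le> C * norm (proj_on I (y - y'))) \<longrightarrow>
       thin_at I L z)"
    proof (intro bexI[of _ "K cs"] conjI allI impI)
      show "z \<in> K cs" using z h(3) by (simp add: K_def)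
    qed (use h(2) in \<open>auto intro: thin\<close>)
  qed
qed

section \<open>Density\<close>

text \<open>The normal vector is the component of y - p orthogonal to the direction space of A, for
  a point p of A.\<close>

lemma affine_separating_functional:
  fixes A :: "(real^'n) set"
  assumes "affine A" "y \<notin> A"
  shows "\<exists>a b. (\<forall>x\<in>A. a \<bullet> x = b) \<and> a \<bullet> y \<noteq> b"
proof (cases "A = {}")
  case True
  \<comment> \<open>On empty A any equation holds, and the zero functional never takes the value
    1.\<close>
  then show ?thesis by (intro exI[of _ 0] exI[of _ 1]) auto
next
  case False
  then obtain p where p: "p \<in> A" by blast
  define L where "L = (\<lambda>x. x - p) ` A"
  have "subspace L" unfolding L_def by (rule affine_diffs_subspace_subtract[OF assms(1) p])
  then have sp: "span L = L" by (simp add: span_eq_iff)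
  obtain l a where la: "l \<in> span L" "\<And>w. w \<in> span L \<Longrightarrow> orthogonal a w" "y - p = l + a"
    by (rule orthogonal_subspace_decomp_exists[of L "y - p"]) blast
  have "a \<noteq> 0"
  proof
    assume "a = 0"
    then have "y - p \<in> L" using la(1,3) sp by simp
    then show False using assms(2) by (auto simp: L_def)
  qed
  have "a \<bullet> x = a \<bullet> p" if "x \<in> A" for x
  proof -
    have "x - p \<in> span L" unfolding sp using that by (auto simp: L_def)
    from la(2)[OF this] show ?thesis by (simp add: orthogonal_def inner_diff_right)
  qed
  moreover have "a \<bullet> (y - p) = a \<bullet> a"
    using la by (simp add: inner_add_right orthogonal_def)
  then have "a \<bullet> y \<noteq> a \<bullet> p" using \<open>a \<noteq> 0\<close> by (auto simp: inner_diff_right)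
  ultimately show ?thesis by blast
qed

text \<open>Each affine hull is spanned by an affinely independent, hence finite, subset, and there
  are countably many finite sets of rational points.\<close>

lemma countable_rational_affine_subspaces:
  "countable {A :: (real^'n) set. rational_affine_subspace A}"
proof -
  define Q where "Q = {x :: real^'n. \<forall>j. x $ j \<in> \<rat>}"
  have "Q \<subseteq> vec_lambda ` (PiE UNIV (\<lambda>_. \<rat>))"
  proof
    fix x assume "x \<in> Q"
    then have "x = vec_lambda (vec_nth x)" "vec_nth x \<in> PiE UNIV (\<lambda>_. \<rat>)"
      by (auto simp: Q_def)
    then show "x \<in> vec_lambda ` (PiE UNIV (\<lambda>_. \<rat>))" by blast
  qed
  then have "countable Q"
    by (rule countable_subset) (intro countable_image countable_PiE finite countable_rat)
  then have "countable {F. finite F \<and> F \<subseteq> Q}" by (rule countable_Collect_finite_subset)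
  then have "countable ((\<lambda>F. affine hull F) ` {F. finite F \<and> F \<subseteq> Q})" by (rule countable_image)
  moreover have "{A. rational_affine_subspace A} \<subseteq> (\<lambda>F. affine hull F) ` {F. finite F \<and> F \<subseteq> Q}"
  proof
    fix A :: "(real^'n) set" assume "A \<in> {A. rational_affine_subspace A}"
    then obtain P where P: "P \<subseteq> Q" "A = affine hull P"
      by (auto simp: rational_affine_subspace_def Q_def)
    obtain F where "\<not> affine_dependent F" "F \<subseteq> P" "affine hull P = affine hull F"
      using affine_basis_exists[of P] by blast
    then show "A \<in> (\<lambda>F. affine hull F) ` {F. finite F \<and> F \<subseteq> Q}"
      using P aff_independent_finite by blast
  qed
  ultimately show ?thesis by (rule countable_subset[rotated])
qed

text \<open>All exclusions enter one countable family: the submanifolds, the sets covering the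
  sections by the hyperplanes (a, b) in H, and the singletons of Z. A limit violating an exclusion
  would lie in a member that is thin at it.\<close>

lemma UA_point_near_avoiding:
  fixes Y :: "(real^'n) set"
  assumes Y: "analytic_submanifold d Y" "connected Y" and x0: "x0 \<in> Y"
    and g: "1 \<le> g" "g \<le> d - 1"
    and f: "\<And>t. t > 0 \<Longrightarrow> f t > 0" "antimono_on {0<..} f"
    and \<R>: "countable \<R>" "\<And>R. R \<in> \<R> \<Longrightarrow> proper_closed_analytic_submanifold_of R Y"
    and H: "countable H" "\<And>a b. (a, b) \<in> H \<Longrightarrow> \<not> (\<forall>y\<in>Y. a \<bullet> y = b)"
    and "countable Z" and "\<epsilon> > 0"
  shows "\<exists>z\<in>Y \<inter> ball x0 \<epsilon>. z \<in> UA f g \<and> z \<notin> \<Union>\<R> \<and> (\<forall>(a, b)\<in>H. a \<bullet> z \<noteq> b) \<and> z \<notin> Z"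
proof -
  obtain U V \<phi> \<psi> S where x0U: "x0 \<in> U" and chart: "adapted_chart Y U V \<phi> \<psi> S" and "dim S = d"
    by (rule analytic_submanifold_chart[OF Y(1) x0]) blast
  note c = adapted_chartD[OF chart]
  obtain I C \<rho>0 where I: "card I = dim S" and \<rho>0: "\<rho>0 > 0" "ball x0 \<rho>0 \<subseteq> U" and
    lip: "\<And>y y'. y \<in> Y \<inter> ball x0 \<rho>0 \<Longrightarrow> y' \<in> Y \<inter> ball x0 \<rho>0 \<Longrightarrow>
        norm (y - y') \<le> C * norm (proj_on I (y - y'))"
    by (rule adapted_chart_coordinates[OF chart x0U]) blast
  \<comment> \<open>Balls of radius \<rho>0 / 2 around points of \<open>cball x0 \<rho>\<close> stay
    where the Lipschitz bound holds, and \<rho> < \<epsilon> puts this closed ball into the open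
    one.\<close>
  define \<rho> where "\<rho> = min \<rho>0 \<epsilon> / 2"
  have \<rho>: "\<rho> > 0" "\<rho> \<le> \<rho>0 / 2" "\<rho> < \<epsilon>" using \<rho>0(1) \<open>\<epsilon> > 0\<close> by (auto simp: \<rho>_def)
  have near: "z \<in> Y \<inter> U" "ball z (\<rho>0 / 2) \<subseteq> ball x0 \<rho>0" if "z \<in> Y \<inter> cball x0 \<rho>" for z
  proof -
    have "z \<in> ball x0 \<rho>0" using that \<rho> \<rho>0(1) by auto
    then show "z \<in> Y \<inter> U" using that \<rho>0(2) by blast
    show "ball z (\<rho>0 / 2) \<subseteq> ball x0 \<rho>0"
      using that \<rho>(2) by (subst ball_subset_ball_iff) (auto simp: dist_commute)
  qed
  have "\<forall>h\<in>H. \<exists>\<K>. countable \<K> \<and>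
    (\<forall>K\<in>\<K>. \<forall>x\<in>Y \<inter> U. x \<notin> K \<longrightarrow> (\<exists>\<epsilon>>0. ball x \<epsilon> \<inter> Y \<inter> K = {})) \<and>
    (\<forall>z\<in>Y \<inter> U. fst h \<bullet> z = snd h \<longrightarrow> (\<exists>K\<in>\<K>. z \<in> K \<and> (\<forall>I C \<rho>. \<rho> > 0 \<longrightarrow>
       (\<forall>y\<in>Y \<inter> ball z \<rho>. \<forall>y'\<in>Y \<inter> ball z \<rho>. norm (y - y') \<le> C * norm (proj_on I (y - y'))) \<longrightarrow>
       thin_at I K z)))"
    by (intro ballI hyperplane_section_covered_by_thin_sets[OF Y chart] H(2)) simp
  then obtain \<K> where \<K>: "\<And>h. h \<in> H \<Longrightarrow> countable (\<K> h)"
    "\<And>h K x. h \<in> H \<Longrightarrow> K \<in> \<K> h \<Longrightarrow> x \<in> Y \<inter> U \<Longrightarrow> x \<notin> K \<Longrightarrow> \<exists>\<epsilon>>0. ball x \<epsilon> \<inter> Y \<inter> K = {}"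
    "\<And>h z. h \<in> H \<Longrightarrow> z \<in> Y \<inter> U \<Longrightarrow> fst h \<bullet> z = snd h \<Longrightarrow> \<exists>K\<in>\<K> h. z \<in> K \<and> (\<forall>I C \<rho>. \<rho> > 0 \<longrightarrow>
       (\<forall>y\<in>Y \<inter> ball z \<rho>. \<forall>y'\<in>Y \<inter> ball z \<rho>. norm (y - y') \<le> C * norm (proj_on I (y - y'))) \<longrightarrow>
       thin_at I K z)"
    by (fastforce dest!: bchoice)
  define \<L> where "\<L> = \<R> \<union> (\<Union>h\<in>H. \<K> h) \<union> (\<lambda>z. {z}) ` Z"
  have "\<exists>z\<in>Y \<inter> cball x0 \<rho>. z \<in> UA f g \<and> (\<forall>K\<in>\<L>. z \<in> K \<longrightarrow> \<not> thin_at I K z)"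
  proof (rule UA_point_avoiding_thin_sets[OF g(1) _ f x0 _ \<rho>(1)])
    show "g \<le> card I - 1" using g(2) I \<open>dim S = d\<close> by simp
    \<comment> \<open>Inside U the set Y is the preimage of the closed subspace S under \<phi>,
      which gives closedness near x0.\<close>
    have "cball x0 \<rho> \<subseteq> U" using \<rho> \<rho>0 by (intro order_trans[OF _ \<rho>0(2)]) auto
    then have "closed (cball x0 \<rho> \<inter> \<phi> -` S)"
      by (intro continuous_closed_preimage continuous_on_subset[OF c(3)] closed_subspace[OF c(5)]) auto
    also have "cball x0 \<rho> \<inter> \<phi> -` S = Y \<inter> cball x0 \<rho>"
      using \<open>cball x0 \<rho> \<subseteq> U\<close> c(10) by blast
    finally show "closed (Y \<inter> cball x0 \<rho>)" .
    show "\<exists>y\<in>Y. y \<noteq> x \<and> dist y x < \<eta> \<and> (\<forall>j\<in>I - {i}. y $ j = x $ j) \<and> y $ i \<in> \<rat>"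
      if "x \<in> Y \<inter> ball x0 \<rho>" "i \<in> I" "\<eta> > 0" for x i \<eta>
      by (rule adapted_chart_moves[OF chart I \<rho>0(2) lip]) (use that \<rho> \<rho>0(1) in auto)
    show "countable \<L>"
      unfolding \<L>_def using \<R>(1) H(1) \<open>countable Z\<close> \<K>(1) by auto
    fix K x assume K: "K \<in> \<L>" and x: "x \<in> Y \<inter> ball x0 \<rho>" "x \<notin> K"
    have xU: "x \<in> Y \<inter> U" using near(1)[of x] x(1) by auto
    consider "K \<in> \<R>" | h where "h \<in> H" "K \<in> \<K> h" | z where "K = {z}" using K by (auto simp: \<L>_def)
    then show "\<exists>\<epsilon>>0. ball x \<epsilon> \<inter> Y \<inter> K = {}"
    proof cases
      case 1
      then have "closedin (top_of_set Y) K"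
        using \<R>(2) by (auto simp: proper_closed_analytic_submanifold_of_def)
      then obtain T where T: "closed T" "K = Y \<inter> T" by (auto simp: closedin_closed)
      then have "open (- T)" "x \<in> - T" using x by auto
      then obtain \<epsilon> where "\<epsilon> > 0" "ball x \<epsilon> \<subseteq> - T" using open_contains_ball by blast
      then show ?thesis using T(2) by blast
    next
      case 2
      then show ?thesis using \<K>(2) xU x(2) by blast
    next
      case 3
      then show ?thesis using x(2) by (intro exI[of _ "dist x z"]) auto
    qed
  qed
  then obtain z where z: "z \<in> Y \<inter> cball x0 \<rho>" "z \<in> UA f g"
    "\<And>K. K \<in> \<L> \<Longrightarrow> z \<in> K \<Longrightarrow> \<not> thin_at I K z" by blast
  have lipz: "norm (y - y') \<le> C * norm (proj_on I (y - y'))"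
    if "y \<in> Y \<inter> ball z (\<rho>0 / 2)" "y' \<in> Y \<inter> ball z (\<rho>0 / 2)" for y y'
    using near(2)[OF z(1)] that by (intro lip) auto
  have "z \<notin> R" if R: "R \<in> \<R>" for R
  proof
    assume "z \<in> R"
    have "\<rho>0 / 2 > 0" using \<rho>0(1) by simp
    then have "thin_at I R z"
      using lipz by (rule proper_closed_submanifold_thin[OF Y \<R>(2)[OF R] \<open>z \<in> R\<close>])
    then show False using z(3)[of R] R \<open>z \<in> R\<close> by (auto simp: \<L>_def)
  qed
  moreover have "a \<bullet> z \<noteq> b" if h: "(a, b) \<in> H" for a b
  proof
    assume "a \<bullet> z = b"
    then obtain K where K: "K \<in> \<K> (a, b)" "z \<in> K" and thin: "\<forall>I C \<rho>. \<rho> > 0 \<longrightarrow>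
       (\<forall>y\<in>Y \<inter> ball z \<rho>. \<forall>y'\<in>Y \<inter> ball z \<rho>. norm (y - y') \<le> C * norm (proj_on I (y - y'))) \<longrightarrow>
       thin_at I K z"
      using \<K>(3)[OF h near(1)[OF z(1)]] by auto
    have "thin_at I K z"
      using thin[rule_format, of "\<rho>0 / 2" C I] lipz \<rho>0(1) by simp
    then show False using z(3)[of K] K h by (auto simp: \<L>_def)
  qed
  moreover have "z \<notin> Z"
  proof
    assume "z \<in> Z"
    \<comment> \<open>Thinness asks for some i in I; for a singleton any element of I
      serves.\<close>
    have "I \<noteq> {}" using g I \<open>dim S = d\<close> by auto
    then have "thin_at I {z} z" unfolding thin_at_def by (auto intro: exI[of _ 1])
    then show False using z(3)[of "{z}"] \<open>z \<in> Z\<close> by (auto simp: \<L>_def)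
  qed
  moreover have "z \<in> Y \<inter> ball x0 \<epsilon>" using z(1) \<rho>(3) by auto
  ultimately show ?thesis using z(2) by (intro bexI[of _ z]) auto
qed

text \<open>Avoiding Z = A contradicts countability of A, and avoiding the empty set gives
  density.\<close>

lemma uncountable_dense_if_avoiding:
  fixes Y A :: "'a::metric_space set"
  assumes "Y \<noteq> {}" and ex: "\<And>x \<epsilon> Z. x \<in> Y \<Longrightarrow> \<epsilon> > 0 \<Longrightarrow> countable Z \<Longrightarrow> \<exists>z\<in>A \<inter> ball x \<epsilon>. z \<notin> Z"
  shows "uncountable A \<and> Y \<subseteq> closure A"
proof
  obtain x where "x \<in> Y" using assms(1) by blast
  then show "uncountable A" using ex[of x 1 A] by auto
  show "Y \<subseteq> closure A"
  proof
    fix y assume y: "y \<in> Y"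
    show "y \<in> closure A"
      unfolding closure_approachable
    proof (intro allI impI)
      fix e :: real assume "e > 0"
      with ex[OF y, of e "{}"] show "\<exists>z\<in>A. dist z y < e" by (auto simp: dist_commute)
    qed
  qed
qed

theorem theorem4p2:
  fixes Y :: "(real^'n) set" and d g :: nat and f :: "real \<Rightarrow> real"
    and R :: "nat \<Rightarrow> (real^'n) set"
  assumes "CARD('n) \<ge> 2"
    and "analytic_submanifold d Y" and "connected Y" and "Y \<noteq> {}"
    and "d \<ge> 2" and "1 \<le> g" and "g \<le> d - 1"
    and "\<And>t. t > 0 \<Longrightarrow> f t > 0" and "antimono_on {0<..} f"
    and "\<And>l. proper_closed_analytic_submanifold_of (R l) Y"
  shows "uncountable (Y \<inter> UA f g - (\<Union>l. R l)) \<and>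
         Y \<subseteq> closure (Y \<inter> UA f g - (\<Union>l. R l)) \<and>
         ((\<forall>A. rational_affine_subspace A \<and> A \<noteq> UNIV \<longrightarrow> \<not> Y \<subseteq> A) \<longrightarrow>
            uncountable (Y \<inter> UA_star f g) \<and> Y \<subseteq> closure (Y \<inter> UA_star f g))"
proof -
  note point = UA_point_near_avoiding[OF assms(2,3) _ assms(6-9)]
  have 1: "uncountable (Y \<inter> UA f g - (\<Union>l. R l)) \<and> Y \<subseteq> closure (Y \<inter> UA f g - (\<Union>l. R l))"
  proof (rule uncountable_dense_if_avoiding[OF assms(4)])
    fix x :: "real^'n" and \<epsilon> :: real and Z :: "(real^'n) set"
    assume "x \<in> Y" "\<epsilon> > 0" "countable Z"
    then have "\<exists>z\<in>Y \<inter> ball x \<epsilon>. z \<in> UA f g \<and> z \<notin> \<Union>(range R) \<and> (\<forall>(a, b)\<in>{}. a \<bullet> z \<noteq> b) \<and> z \<notin> Z"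
      by (intro point) (use assms(10) in auto)
    then show "\<exists>z\<in>(Y \<inter> UA f g - (\<Union>l. R l)) \<inter> ball x \<epsilon>. z \<notin> Z" by auto
  qed
  \<comment> \<open>Each proper rational affine subspace lies in the solution set of an affine
    equation that fails somewhere on Y. There are countably many such subspaces, so all these
    solution sets can be avoided together.\<close>
  have 2: "uncountable (Y \<inter> UA_star f g) \<and> Y \<subseteq> closure (Y \<inter> UA_star f g)"
    if "\<forall>A. rational_affine_subspace A \<and> A \<noteq> UNIV \<longrightarrow> \<not> Y \<subseteq> A"
  proof (rule uncountable_dense_if_avoiding[OF assms(4)])
    fix x :: "real^'n" and \<epsilon> :: real and Z :: "(real^'n) set"
    assume *: "x \<in> Y" "\<epsilon> > 0" "countable Z"
    define \<A> where "\<A> = {A :: (real^'n) set. rational_affine_subspace A \<and> A \<noteq> UNIV}"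
    have "countable \<A>"
      unfolding \<A>_def by (rule countable_subset[OF _ countable_rational_affine_subspaces]) auto
    have "\<forall>A\<in>\<A>. \<exists>h. (\<forall>x\<in>A. fst h \<bullet> x = snd h) \<and> \<not> (\<forall>y\<in>Y. fst h \<bullet> y = snd h)"
    proof
      fix A assume A: "A \<in> \<A>"
      then have "\<not> Y \<subseteq> A" using that by (auto simp: \<A>_def)
      then obtain y where y: "y \<in> Y" "y \<notin> A" by blast
      have "affine A" using A by (auto simp: \<A>_def rational_affine_subspace_def)
      from affine_separating_functional[OF this y(2)] y(1)
      show "\<exists>h. (\<forall>x\<in>A. fst h \<bullet> x = snd h) \<and> \<not> (\<forall>y\<in>Y. fst h \<bullet> y = snd h)" by fastforce
    qed
    then have "\<exists>h. \<forall>A\<in>\<A>. (\<forall>x\<in>A. fst (h A) \<bullet> x = snd (h A)) \<and>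
        \<not> (\<forall>y\<in>Y. fst (h A) \<bullet> y = snd (h A))"
      by (rule bchoice)
    then obtain h where h: "\<And>A x. A \<in> \<A> \<Longrightarrow> x \<in> A \<Longrightarrow> fst (h A) \<bullet> x = snd (h A)"
      "\<And>A. A \<in> \<A> \<Longrightarrow> \<not> (\<forall>y\<in>Y. fst (h A) \<bullet> y = snd (h A))"
      by blast
    \<comment> \<open>The claim on \<open>UA_star\<close> does not remove the sets R l, so the
      family of submanifolds is empty here.\<close>
    have "\<exists>z\<in>Y \<inter> ball x \<epsilon>. z \<in> UA f g \<and> z \<notin> \<Union>{} \<and> (\<forall>(a, b)\<in>h ` \<A>. a \<bullet> z \<noteq> b) \<and> z \<notin> Z"
    proof (rule point)
      show "countable (h ` \<A>)" using \<open>countable \<A>\<close> by (rule countable_image)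
      show "\<not> (\<forall>y\<in>Y. a \<bullet> y = b)" if ab: "(a, b) \<in> h ` \<A>" for a b
      proof -
        obtain A where "A \<in> \<A>" "h A = (a, b)" using ab by force
        with h(2)[of A] show ?thesis by simp
      qed
    qed (use * in auto)
    then obtain z where z: "z \<in> Y \<inter> ball x \<epsilon>" "z \<in> UA f g" "\<forall>(a, b)\<in>h ` \<A>. a \<bullet> z \<noteq> b" "z \<notin> Z" by blast
    have "z \<notin> A" if "A \<in> \<A>" for A
      using z(3) h(1)[OF that, of z] that by (cases "h A") force
    then have "z \<in> UA_star f g" using z(2) by (auto simp: UA_star_def \<A>_def)
    with z show "\<exists>z\<in>(Y \<inter> UA_star f g) \<inter> ball x \<epsilon>. z \<notin> Z" by blast
  qed
  show ?thesis
    by (intro conjI impI 1[THEN conjunct1] 1[THEN conjunct2] 2[THEN conjunct1] 2[THEN conjunct2])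
qed

end
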